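(* Let $G$ be an $n$-vertex graph given as a stream in the AL model, together with a set $X \subseteq V(G)$ with $|X| = k$ such that $G - X$ is a disjoint union of $\ell$ cliques. Then \textsc{Diameter} and \textsc{Connectivity} on $G$ can each be solved using $O(2^k k \ell)$ passes and $O((k+\ell)\log n)$ bits of memory, and can also each be solved using one pass and $O(2^k \ell + (k+\ell)\log n)$ bits of memory.
   Context: Graphs are finite, simple, undirected, unweighted. \textsc{Diameter}: compute $\max_{s,t} d(s,t)$, with $d$ the shortest-path distance ($+\infty$ between different components); \textsc{Connectivity}: decide whether $G$ is connected. In the Adjacency List (AL) streaming model the graph arrives as a sequence of vertices in arbitrary fixed order, each together with the full list of its incident edges (each edge appears twice). A $p$-pass algorithm reads the sequence $p$ times with unlimited computation; memory is measured in bits. *)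

theory Defs
  imports "Graph_Theory.Graph_Theory" "HOL-Library.Disjoint_Sets"
begin

text \<open>
  Simple graphs are the symmetric loop-free digraphs of locale \<^locale>\<open>pair_graph\<close>: an undirected
  edge between \<open>u\<close> and \<open>v\<close> is the pair of arcs \<open>(u, v)\<close>, \<open>(v, u)\<close>.
\<close>

definition graph_dist :: "'a pair_pre_digraph \<Rightarrow> 'a \<Rightarrow> 'a \<Rightarrow> ereal" where
  "graph_dist G s t = wf_digraph.\<mu> (with_proj G) (\<lambda>_. 1) s t"

definition diameter :: "'a pair_pre_digraph \<Rightarrow> ereal" where
  "diameter G = Max {graph_dist G s t | s t. s \<in> pverts G \<and> t \<in> pverts G}"

definition connectivity :: "'a pair_pre_digraph \<Rightarrow> bool" where
  "connectivity G \<longleftrightarrow> Digraph_Component.connected (with_proj G)"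

definition disjoint_union_of_cliques :: "('a, 'a \<times> 'a) pre_digraph \<Rightarrow> nat \<Rightarrow> bool" where
  "disjoint_union_of_cliques H l \<longleftrightarrow>
     (\<exists>P. partition_on (verts H) P \<and> finite P \<and> card P = l \<and>
          arcs_ends H = (\<Union>C\<in>P. {(u, v). u \<in> C \<and> v \<in> C \<and> u \<noteq> v}))"

text \<open>
  An adjacency list stream is read item by item: each vertex is announced and followed by its
  incident edges, one item per edge. Memory is thus charged also in the middle of an adjacency list.
  The marker \<open>Pass_End\<close> is not part of the stream; it tells the algorithm that a pass is over.
\<close>

datatype al_item = Vertex nat | Edge nat nat | Pass_End

text \<open>Both the order of the vertices and the order within each list are arbitrary.\<close>

definition al_stream :: "nat pair_pre_digraph \<Rightarrow> al_item list \<Rightarrow> bool" where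
  "al_stream G \<sigma> \<longleftrightarrow>
     (\<exists>vs nb. distinct vs \<and> set vs = pverts G \<and>
        (\<forall>v\<in>pverts G. distinct (nb v) \<and> set (nb v) = {u. (v, u) \<in> parcs G}) \<and>
        \<sigma> = concat (map (\<lambda>v. Vertex v # map (Edge v) (nb v)) vs))"

text \<open>
  The memory is a bit string, and the functions below see nothing else: the number of vertices and
  the modulator are available only as far as the initial memory stores them, and the number of
  cliques is not supplied at all. The functions are arbitrary (unlimited computation).
  At the start and after each pass, \<open>result\<close> either asks for a further pass (\<open>None\<close>) or halts.
\<close>

record 'o streaming_alg =
  init_mem :: "nat \<Rightarrow> nat set \<Rightarrow> bool list"
  step :: "bool list \<Rightarrow> al_item \<Rightarrow> bool list"
  result :: "bool list \<Rightarrow> 'o option"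

definition passes :: "nat \<Rightarrow> al_item list \<Rightarrow> al_item list" where
  "passes p \<sigma> = concat (replicate p (\<sigma> @ [Pass_End]))"

definition mem_after :: "'o streaming_alg \<Rightarrow> nat \<Rightarrow> nat set \<Rightarrow> al_item list \<Rightarrow> bool list" where
  "mem_after A n X items = foldl (step A) (init_mem A n X) items"

definition outputs_within ::
  "'o streaming_alg \<Rightarrow> nat \<Rightarrow> nat set \<Rightarrow> al_item list \<Rightarrow> 'o \<Rightarrow> real \<Rightarrow> real \<Rightarrow> bool" where
  "outputs_within A n X \<sigma> ans max_passes max_bits \<longleftrightarrow>
     (\<exists>p. real p \<le> max_passes \<and>
        (\<forall>q<p. result A (mem_after A n X (passes q \<sigma>)) = None) \<and>
        result A (mem_after A n X (passes p \<sigma>)) = Some ans \<and>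
        (\<forall>i. real (length (mem_after A n X (take i (passes p \<sigma>)))) \<le> max_bits))"

text \<open>
  One algorithm solves all instances; the pass and memory budgets are functions of \<open>n\<close>, \<open>k\<close>, \<open>l\<close>.
\<close>

definition solvable_with_clique_modulator ::
  "(nat pair_pre_digraph \<Rightarrow> 'o) \<Rightarrow> (nat \<Rightarrow> nat \<Rightarrow> nat \<Rightarrow> real) \<Rightarrow> (nat \<Rightarrow> nat \<Rightarrow> nat \<Rightarrow> real) \<Rightarrow> bool"
  where
  "solvable_with_clique_modulator problem pass_bound bit_bound \<longleftrightarrow>
     (\<exists>A :: 'o streaming_alg. \<forall>n k l G X \<sigma>.
        pair_graph G \<and> pverts G = {..<n} \<and> X \<subseteq> pverts G \<and> card X = k \<and> 1 \<le> l \<and>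
        disjoint_union_of_cliques (with_proj G \<restriction> (pverts G - X)) l \<and> al_stream G \<sigma> \<longrightarrow>
        outputs_within A n X \<sigma> (problem G) (pass_bound n k l) (bit_bound n k l))"

end

theory Submission
  imports Defs
begin

text \<open>
  Choose one representative in every clique of \<open>G - X\<close>, and call the pair of the representative of \<open>v\<close>
  and \<open>N(v) \<inter> X\<close> the class of \<open>v\<close>. Both are known once the list of \<open>v\<close> has been read, provided the
  edges from \<open>v\<close> to \<open>X\<close> and to the representatives have been noted.

  One pass suffices to record which of the at most \<open>2\<^sup>k l\<close> classes occur, together with \<open>G[X]\<close>. This
  determines the diameter: a map that sends every vertex of one graph to a vertex of the same class
  in another graph does not increase distances, and vertices of the same class are adjacent.

  With many passes, a breadth-first search is run from every class and from every vertex of \<open>X\<close>. It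
  stores only one distance for each vertex of \<open>X\<close> and one for each clique, the distance of the nearest
  vertex of that clique. Finite distances are at most \<open>3k + 1\<close>, so \<open>3k + 1\<close> relaxing passes make the
  estimates exact; one more pass reads off the eccentricity.
\<close>

section \<open>Distances in a graph with a clique modulator\<close>

text \<open>With O((k+l) log n) bits one can remember neither which classes occur nor a distance for
  every vertex. This forces two devices. First, all pairs of a representative and a subset of
  \<open>X\<close> serve as sources, addressed by an index of about k + log l bits; many pairs fit
  no vertex, so each search also checks whether its source occurs, and otherwise its result is
  discarded. Second, the value stored for a clique does not tell which of its vertices attains it.
  Distances inside a clique differ by at most 1, so a vertex \<open>v\<close> outside
  \<open>X\<close> is served by the smallest of the clique value plus 1 and the values of its
  neighbours in \<open>X\<close> plus 1. This is exact except at the source itself.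

  Both algorithms thus err only by reporting 1 where the distance is 0, which is harmless once there
  are two vertices. Two degenerate cases are separate: for n = 1 the factor log n vanishes, and for
  k = 0 the pass bound 2^k k l vanishes, so the answer must come after a single pass.

  The number of cliques is unknown to the algorithm; a greedy independent set of representatives
  replaces it.\<close>

locale clique_modulator =
  fixes V :: "'a set" and E :: "'a rel" and X :: "'a set"
  assumes finite_V: "finite V" and E_V: "E \<subseteq> V \<times> V" and sym_E: "sym E" and irrefl_E: "irrefl E"
    and X_V: "X \<subseteq> V"
    and clique_trans: "\<lbrakk>(u, v) \<in> E; (v, w) \<in> E; u \<noteq> w; u \<notin> X; v \<notin> X; w \<notin> X\<rbrakk> \<Longrightarrow> (u, w) \<in> E"
begin

definition dist :: "'a \<Rightarrow> 'a \<Rightarrow> nat" where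
  "dist s v = (LEAST m. (s, v) \<in> E ^^ m)"

text \<open>One more than the largest finite distance. It stands for infinity and depends only on
  \<open>card X\<close>, so an algorithm that stores \<open>X\<close> can compute it.\<close>

definition cap :: nat where
  "cap = 3 * card X + 2"

definition cdist :: "'a \<Rightarrow> 'a \<Rightarrow> nat" where
  "cdist s v = (if (s, v) \<in> E\<^sup>* then dist s v else cap)"

lemma finite_X: "finite X"
  using X_V finite_V finite_subset by blast

lemma E_sym: "(u, v) \<in> E \<Longrightarrow> (v, u) \<in> E"
  using sym_E by (rule symD)

lemma E_irrefl: "(u, u) \<notin> E"
  using irrefl_E by (simp add: irrefl_def)

lemma E_in_V: "(u, v) \<in> E \<Longrightarrow> u \<in> V" "(u, v) \<in> E \<Longrightarrow> v \<in> V"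
  using E_V by auto

lemma dist_relpow: "(s, v) \<in> E\<^sup>* \<Longrightarrow> (s, v) \<in> E ^^ dist s v"
  unfolding dist_def by (rule LeastI_ex) (simp add: rtrancl_power)

lemma dist_le: "(s, v) \<in> E ^^ m \<Longrightarrow> dist s v \<le> m"
  unfolding dist_def by (rule Least_le)

lemma dist_triangle:
  assumes "(s, u) \<in> E\<^sup>*" "(u, v) \<in> E ^^ m" shows "dist s v \<le> dist s u + m"
  using dist_le[of s v "dist s u + m"] dist_relpow[OF assms(1)] assms(2) by (auto simp: relpow_add)

lemma shortest_path:
  assumes "(s, v) \<in> E\<^sup>*"
  obtains f where "f 0 = s" "f (dist s v) = v" "\<And>i. i < dist s v \<Longrightarrow> (f i, f (Suc i)) \<in> E"
    "\<And>i. i \<le> dist s v \<Longrightarrow> (s, f i) \<in> E\<^sup>* \<and> dist s (f i) = i"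
proof -
  obtain f where f: "f 0 = s" "f (dist s v) = v" "\<And>i. i < dist s v \<Longrightarrow> (f i, f (Suc i)) \<in> E"
    using dist_relpow[OF assms] by (auto simp: relpow_fun_conv)
  have seg: "(f i, f j) \<in> E ^^ (j - i)" if "i \<le> j" "j \<le> dist s v" for i j
    unfolding relpow_fun_conv using that f(3) by (intro exI[of _ "\<lambda>m. f (i + m)"]) auto
  have "(s, f i) \<in> E\<^sup>* \<and> dist s (f i) = i" if i: "i \<le> dist s v" for i
  proof -
    have si: "(s, f i) \<in> E ^^ i" using seg[of 0 i] i f(1) by simp
    hence r: "(s, f i) \<in> E\<^sup>*" using rtrancl_power by blast
    have "dist s v \<le> dist s (f i) + (dist s v - i)"
      using dist_triangle[OF r seg[of i "dist s v"]] i f(2) by simp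
    with dist_le[OF si] r i show ?thesis by simp
  qed
  with f that show ?thesis by blast
qed

text \<open>
  Among three consecutive vertices of a shortest path, one lies in \<open>X\<close>: otherwise all three lie in the
  same clique and the path has a shortcut. Choosing such a vertex in every block of three gives an
  injection into \<open>X\<close>.
\<close>

lemma dist_less_cap:
  assumes "(s, v) \<in> E\<^sup>*" shows "dist s v < cap"
proof (rule ccontr)
  assume "\<not> dist s v < cap"
  hence d: "3 * card X + 2 \<le> dist s v" by (simp add: cap_def)
  obtain f where f: "\<And>i. i < dist s v \<Longrightarrow> (f i, f (Suc i)) \<in> E"
    "\<And>i. i \<le> dist s v \<Longrightarrow> (s, f i) \<in> E\<^sup>* \<and> dist s (f i) = i"
    using shortest_path[OF assms] by metis
  \<comment> \<open>Positions 0 to 3k+2 of the path form k+1 full blocks, one more than there are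
    vertices in \<open>X\<close>. The block is read off from the vertex as its distance divided by
    3.\<close>
  have "\<exists>x\<in>X. dist s x div 3 = j" if j: "j \<le> card X" for j
  proof (rule ccontr)
    assume no: "\<not> ?thesis"
    have le: "3 * j + 2 \<le> dist s v" using d j by simp
    have nX: "f (3 * j + i) \<notin> X" if "i \<le> 2" for i
      using no f(2)[of "3 * j + i"] le that by auto
    have e1: "(f (3 * j), f (3 * j + 1)) \<in> E" and e2: "(f (3 * j + 1), f (3 * j + 2)) \<in> E"
      using f(1)[of "3 * j"] f(1)[of "3 * j + 1"] le by auto
    have "f (3 * j) \<noteq> f (3 * j + 2)"
      using f(2)[of "3 * j"] f(2)[of "3 * j + 2"] le by auto
    hence "(f (3 * j), f (3 * j + 2)) \<in> E"
      using clique_trans[OF e1 e2] nX[of 0] nX[of 1] nX[of 2] by simp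
    hence "dist s (f (3 * j + 2)) \<le> dist s (f (3 * j)) + 1"
      using f(2)[of "3 * j"] le by (intro dist_triangle) auto
    thus False using f(2)[of "3 * j"] f(2)[of "3 * j + 2"] le by simp
  qed
  hence "{..card X} \<subseteq> (\<lambda>x. dist s x div 3) ` X" by fastforce
  hence "card {..card X} \<le> card X" using surj_card_le[OF finite_X] by blast
  thus False by simp
qed

lemma cdist_self: "cdist s s = 0"
  using dist_le[of s s 0] by (simp add: cdist_def)

lemma cdist_le_cap: "cdist s v \<le> cap"
  using dist_less_cap by (auto simp: cdist_def less_imp_le)

lemma cdist_less_cap_iff: "cdist s v < cap \<longleftrightarrow> (s, v) \<in> E\<^sup>*"
  using dist_less_cap by (auto simp: cdist_def)

lemma cdist_step: "(u, v) \<in> E \<Longrightarrow> cdist s v \<le> cdist s u + 1"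
proof -
  assume uv: "(u, v) \<in> E"
  show ?thesis
  proof (cases "(s, u) \<in> E\<^sup>*")
    case True
    hence "(s, v) \<in> E\<^sup>*" using uv by (rule rtrancl_into_rtrancl)
    with True show ?thesis using dist_triangle[OF True, of v 1] uv by (simp add: cdist_def)
  next
    case False
    thus ?thesis using cdist_le_cap[of s v] by (simp add: cdist_def)
  qed
qed

lemma cdist_le_relpow: "(s, v) \<in> E ^^ m \<Longrightarrow> cdist s v \<le> m"
  using dist_le by (auto simp: cdist_def rtrancl_power)

text \<open>Below \<open>cap\<close> the value is a true distance, so the path ends with an edge
  from the previous level; at \<open>cap\<close> it means unreachable and offers no
  predecessor.\<close>

lemma cdist_pred:
  assumes "cdist s v = Suc t" "Suc t < cap"
  obtains u where "(u, v) \<in> E" "cdist s u = t"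
proof -
  have r: "(s, v) \<in> E\<^sup>*" using assms cdist_less_cap_iff by metis
  obtain f where f: "f (dist s v) = v" "\<And>i. i < dist s v \<Longrightarrow> (f i, f (Suc i)) \<in> E"
    "\<And>i. i \<le> dist s v \<Longrightarrow> (s, f i) \<in> E\<^sup>* \<and> dist s (f i) = i"
    using shortest_path[OF r] by metis
  have "dist s v = Suc t" using assms r by (simp add: cdist_def)
  thus ?thesis using f(1) f(2)[of t] f(3)[of t] by (intro that[of "f t"]) (auto simp: cdist_def)
qed

lemma cdist_zero: "cdist s v = 0 \<Longrightarrow> v = s"
  using dist_relpow[of s v] by (auto simp: cdist_def cap_def split: if_splits)

definition ecc_max :: nat where
  "ecc_max = Max {cdist s v | s v. s \<in> V \<and> v \<in> V}"

lemma finite_cdists: "finite {cdist s v | s v. s \<in> V \<and> v \<in> V}"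
  using finite_V by (intro finite_image_set2) simp_all

lemma cdist_le_ecc_max: "s \<in> V \<Longrightarrow> v \<in> V \<Longrightarrow> cdist s v \<le> ecc_max"
  unfolding ecc_max_def using finite_cdists by (intro Max_ge) auto

lemma ecc_max_attained:
  assumes "V \<noteq> {}" obtains s v where "s \<in> V" "v \<in> V" "ecc_max = cdist s v"
proof -
  have "ecc_max \<in> {cdist s v | s v. s \<in> V \<and> v \<in> V}"
    unfolding ecc_max_def using finite_cdists assms by (intro Max_in) auto
  thus ?thesis using that by auto
qed

lemma ecc_maxI:
  assumes "\<And>s v. s \<in> V \<Longrightarrow> v \<in> V \<Longrightarrow> cdist s v \<le> m" "s \<in> V" "v \<in> V" "m \<le> cdist s v"
  shows "ecc_max = m"
  using assms cdist_le_ecc_max[of s v] ecc_max_attained by (metis antisym empty_iff le_trans)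

text \<open>Absorbs the term \<open>max 1\<close> in \<open>represented_cdist_le\<close>, which
  comes from distinct vertices of the same class.\<close>

lemma ecc_max_ge_1:
  assumes "2 \<le> card V" shows "1 \<le> ecc_max"
proof -
  obtain u v where "u \<in> V" "v \<in> V" "u \<noteq> v"
    using assms card_le_Suc0_iff_eq[OF finite_V] by (metis Suc_n_not_le_n le_trans numeral_2_eq_2)
  thus ?thesis using cdist_zero[of u v] cdist_le_ecc_max[of u v] by fastforce
qed

end

section \<open>Capped distances and the distances of the digraph library\<close>

definition of_cap :: "nat \<Rightarrow> nat \<Rightarrow> ereal" where
  "of_cap K m = (if m < K then ereal (real m) else \<infinity>)"

lemma of_cap_mono: "m \<le> m' \<Longrightarrow> of_cap K m \<le> of_cap K m'"
  by (simp add: of_cap_def)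

lemma pcas_relpow: "pcas s p v \<Longrightarrow> set p \<subseteq> E \<Longrightarrow> (s, v) \<in> E ^^ length p"
  by (induction s p v rule: pcas.induct) (auto intro: relpow_Suc_I2 simp del: relpow.simps(2))

lemma relpow_pcas: "(s, v) \<in> E ^^ m \<Longrightarrow> \<exists>p. pcas s p v \<and> set p \<subseteq> E \<and> length p = m"
proof (induction m arbitrary: s)
  case (Suc m)
  then obtain u p where "(s, u) \<in> E" "pcas u p v" "set p \<subseteq> E" "length p = m"
    by (meson relpow_Suc_D2)
  thus ?case by (intro exI[of _ "(s, u) # p"]) auto
qed auto

context pair_wf_digraph
begin

lemma awalk_iff: "s \<in> pverts G \<Longrightarrow> awalk s p v \<longleftrightarrow> set p \<subseteq> parcs G \<and> pcas s p v"
  by (simp add: awalk_def)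

lemma graph_dist_reachable:
  assumes "s \<in> pverts G" "(s, v) \<in> (parcs G)\<^sup>*"
  shows "graph_dist G s v = ereal (real (LEAST m. (s, v) \<in> parcs G ^^ m))" (is "_ = ereal (real ?d)")
proof -
  have cost: "awalk_cost (\<lambda>_. 1) p = real (length p)" for p :: "('a \<times> 'a) list"
    by (simp add: awalk_cost_def sum_list_triv)
  have "\<exists>m. (s, v) \<in> parcs G ^^ m" using assms(2) by (simp add: rtrancl_power)
  hence "(s, v) \<in> parcs G ^^ ?d" by (rule LeastI_ex)
  from relpow_pcas[OF this] obtain p where "pcas s p v" "set p \<subseteq> parcs G" "length p = ?d" by auto
  hence p: "awalk s p v" "length p = ?d" using awalk_iff[OF assms(1)] by auto
  have "?d \<le> length q" if "awalk s q v" for q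
  proof (rule Least_le)
    show "(s, v) \<in> parcs G ^^ length q" using that pcas_relpow[of s q v] awalk_iff[OF assms(1)] by simp
  qed
  thus ?thesis
    unfolding graph_dist_def \<mu>_def using p
    by (intro antisym INF_greatest INF_lower2[of p]) (auto simp: cost)
qed

lemma graph_dist_unreachable:
  assumes "(s, v) \<notin> (parcs G)\<^sup>*" shows "graph_dist G s v = \<infinity>"
  unfolding graph_dist_def using assms reachable_conv by (intro shortest_path_inf) auto

end

locale clique_modulator_graph =
  pair_graph G + clique_modulator "pverts G" "parcs G" X for G :: "nat pair_pre_digraph" and X
begin

lemma graph_dist_eq: "s \<in> pverts G \<Longrightarrow> graph_dist G s v = of_cap cap (cdist s v)"
  using graph_dist_reachable[of s v] graph_dist_unreachable[of s v] dist_less_cap[of s v]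
  by (auto simp: of_cap_def cdist_def dist_def)

lemma diameter_eq:
  assumes "pverts G \<noteq> {}" shows "diameter G = of_cap cap ecc_max"
proof -
  have "{graph_dist G s t | s t. s \<in> pverts G \<and> t \<in> pverts G}
      = of_cap cap ` {cdist s t | s t. s \<in> pverts G \<and> t \<in> pverts G}"
    (is "?A = _ ` ?B")
  proof -
    have A: "?A = (\<lambda>(s, t). graph_dist G s t) ` (pverts G \<times> pverts G)" by auto
    have B: "?B = (\<lambda>(s, t). cdist s t) ` (pverts G \<times> pverts G)" by auto
    show ?thesis unfolding A B image_image using graph_dist_eq by (intro image_cong) auto
  qed
  thus ?thesis unfolding diameter_def ecc_max_def
    using assms finite_cdists by (subst mono_Max_commute) (auto intro: monoI of_cap_mono)
qed

lemma connectivity_iff: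
  assumes "pverts G \<noteq> {}" shows "connectivity G \<longleftrightarrow> diameter G \<noteq> \<infinity>"
proof -
  \<comment> \<open>The library calls a digraph connected if its symmetric closure is strongly
    connected; for a symmetric arc set the closure changes nothing.\<close>
  have ms: "mk_symmetric (with_proj G) = G"
    using E_sym by (intro pair_pre_digraph.equality) (auto simp: mk_symmetric_def)
  have "connectivity G \<longleftrightarrow> (\<forall>u\<in>pverts G. \<forall>v\<in>pverts G. cdist u v < cap)"
    unfolding connectivity_def connected_def ms strongly_connected_def
    using assms by (simp add: reachable_conv cdist_less_cap_iff)
  also have "\<dots> \<longleftrightarrow> ecc_max < cap"
    using cdist_le_ecc_max ecc_max_attained[OF assms] by (metis le_less_trans)
  finally show ?thesis using diameter_eq[OF assms] by (simp add: of_cap_def)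
qed

end

section \<open>Consequences of the clique partition\<close>

definition instance_of ::
  "nat \<Rightarrow> nat \<Rightarrow> nat \<Rightarrow> nat pair_pre_digraph \<Rightarrow> nat set \<Rightarrow> bool" where
  "instance_of n k l G X \<longleftrightarrow> pair_graph G \<and> pverts G = {..<n} \<and> X \<subseteq> pverts G \<and> card X = k \<and> 1 \<le> l \<and>
     disjoint_union_of_cliques (with_proj G \<restriction> (pverts G - X)) l"

lemma induce_arcs_ends:
  "arcs_ends (with_proj G \<restriction> S) = {(u, v) \<in> parcs G. u \<in> S \<and> v \<in> S}"
  by (auto simp: arcs_ends_conv induce_subgraph_def)

text \<open>Two arcs outside \<open>X\<close> that share a vertex lie in the same block, whence
  transitivity. A block meets an independent set at most once, which bounds every greedily chosen
  set of representatives by \<open>l\<close>. Blocks are nonempty, disjoint and outside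
  \<open>X\<close>; the resulting \<open>k + l \<le> n\<close> lets counters of size O(k + l) fit
  into O(log n) bits and excludes n = 0.\<close>

lemma
  assumes "instance_of n k l G X"
  shows instance_of_modulator: "clique_modulator_graph G X"
    and instance_of_independent: "\<lbrakk>R \<subseteq> pverts G - X; R \<times> R \<inter> parcs G = {}\<rbrakk> \<Longrightarrow> card R \<le> l"
    and instance_of_n: "k + l \<le> n"
proof -
  interpret pair_graph G using assms by (simp add: instance_of_def)
  obtain P where P: "partition_on (pverts G - X) P" "finite P" "card P = l"
    and arcs: "{(u, v) \<in> parcs G. u \<in> pverts G - X \<and> v \<in> pverts G - X}
      = (\<Union>C\<in>P. {(u, v). u \<in> C \<and> v \<in> C \<and> u \<noteq> v})"
    using assms by (auto simp: instance_of_def disjoint_union_of_cliques_def induce_arcs_ends)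
  have adj: "(u, v) \<in> parcs G \<longleftrightarrow> (\<exists>C\<in>P. u \<in> C \<and> v \<in> C \<and> u \<noteq> v)"
    if "u \<in> pverts G - X" "v \<in> pverts G - X" for u v
    using arcs that by (auto simp: set_eq_iff)
  have uniq: "C = D" if "C \<in> P" "D \<in> P" "v \<in> C" "v \<in> D" for C D v
    using P(1) that by (metis disjoint_def disjoint_iff partition_onD2)
  show "clique_modulator_graph G X"
  proof unfold_locales
    show "sym (parcs G)" using pair_sym_arcs by (simp add: symmetric_def)
    show "irrefl (parcs G)" using no_loops' by (auto simp: irrefl_def)
    show "X \<subseteq> pverts G" using assms unfolding instance_of_def by blast
    fix u v w
    assume uv: "(u, v) \<in> parcs G" and vw: "(v, w) \<in> parcs G" and "u \<noteq> w" "u \<notin> X" "v \<notin> X" "w \<notin> X"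
    moreover from uv vw have "u \<in> pverts G" "v \<in> pverts G" "w \<in> pverts G"
      by (auto dest: wellformed')
    ultimately show "(u, w) \<in> parcs G" using adj uniq by (metis DiffI)
  qed (auto simp: wellformed')
  {
    assume R: "R \<subseteq> pverts G - X" "R \<times> R \<inter> parcs G = {}"
    have "\<exists>C\<in>P. r \<in> C" if "r \<in> R" for r
      using that R(1) partition_onD1[OF P(1)] by auto
    then obtain c where c: "\<And>r. r \<in> R \<Longrightarrow> c r \<in> P \<and> r \<in> c r" by metis
    have "inj_on c R"
    proof (rule inj_onI, rule ccontr)
      fix r r' assume "r \<in> R" "r' \<in> R" "c r = c r'" "r \<noteq> r'"
      hence "(r, r') \<in> parcs G" using adj[of r r'] c[of r] c[of r'] R(1) by auto
      thus False using R(2) \<open>r \<in> R\<close> \<open>r' \<in> R\<close> by auto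
    qed
    thus "card R \<le> l" using card_inj_on_le[of c R P] c P by auto
  }
  have "\<forall>C\<in>P. \<exists>v. v \<in> C" using partition_onD3[OF P(1)] by (metis equals0I)
  then obtain pick where pick: "\<And>C. C \<in> P \<Longrightarrow> pick C \<in> C" by metis
  have "card P \<le> card (pverts G - X)"
  proof (rule card_inj_on_le)
    show "inj_on pick P" using uniq pick by (intro inj_onI) metis
    show "pick ` P \<subseteq> pverts G - X" using pick partition_onD1[OF P(1)] by auto
    show "finite (pverts G - X)" using pair_finite_verts by simp
  qed
  moreover have V: "pverts G = {..<n}" and "X \<subseteq> pverts G" "card X = k"
    using assms unfolding instance_of_def by blast+
  hence "X \<subseteq> {..<n}" by simp
  hence "card (pverts G - X) = n - k" "k \<le> n"
    using card_mono[of "{..<n}" X] finite_subset[of X "{..<n}"] V \<open>card X = k\<close> by (auto simp: card_Diff_subset)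
  ultimately show "k + l \<le> n" using P(3) by simp
qed

section \<open>Streaming algorithms that act once per vertex\<close>

text \<open>The continuation bits double the binary length but make the code self-delimiting, so
  that fields can be concatenated without storing lengths.\<close>

fun code_nat :: "nat \<Rightarrow> bool list" where
  "code_nat m = (if m = 0 then [False] else True # odd m # code_nat (m div 2))"

declare code_nat.simps [simp del]

definition code_list :: "('a \<Rightarrow> bool list) \<Rightarrow> 'a list \<Rightarrow> bool list" where
  "code_list e xs = concat (map (\<lambda>x. True # e x) xs) @ [False]"

text \<open>Phrased as unique parsing in front of an arbitrary rest, the form that passes from
  entries to lists by induction.\<close>

definition prefix_free :: "('a \<Rightarrow> bool list) \<Rightarrow> bool" where
  "prefix_free e \<longleftrightarrow> (\<forall>x y u v. e x @ u = e y @ v \<longrightarrow> x = y \<and> u = v)"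

lemma prefix_freeD: "prefix_free e \<Longrightarrow> e x @ u = e y @ v \<Longrightarrow> x = y \<and> u = v"
  unfolding prefix_free_def by blast

lemma prefix_free_code_nat: "prefix_free code_nat"
proof -
  have "\<forall>y. code_nat x @ u = code_nat y @ v \<longrightarrow> x = y \<and> u = v" for x u v
  proof (induction x rule: less_induct)
    case (less x)
    show ?case
    proof (intro allI impI)
      fix y assume eq: "code_nat x @ u = code_nat y @ v"
      show "x = y \<and> u = v"
      proof (cases "x = 0 \<or> y = 0")
        case True
        with eq show ?thesis by (auto simp: code_nat.simps[of x] code_nat.simps[of y] split: if_splits)
      next
        case False
        hence "odd x = odd y" "code_nat (x div 2) @ u = code_nat (y div 2) @ v"
          using eq by (simp_all add: code_nat.simps[of x] code_nat.simps[of y])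
        moreover from this have "x div 2 = y div 2 \<and> u = v" using less.IH[of "x div 2"] False by simp
        ultimately show ?thesis
          by (metis div_mult_mod_eq odd_iff_mod_2_eq_one parity_cases)
      qed
    qed
  qed
  thus ?thesis unfolding prefix_free_def by blast
qed

lemma prefix_free_code_list:
  assumes "prefix_free e" shows "prefix_free (code_list e)"
proof -
  have "code_list e xs @ u = code_list e ys @ v \<Longrightarrow> xs = ys \<and> u = v" for xs ys u v
  proof (induction xs arbitrary: ys)
    case Nil
    thus ?case by (cases ys) (auto simp: code_list_def)
  next
    case (Cons x xs)
    then obtain y ys' where ys: "ys = y # ys'" by (cases ys) (auto simp: code_list_def)
    have "e x @ (code_list e xs @ u) = e y @ (code_list e ys' @ v)"
      using Cons.prems by (simp add: ys code_list_def)
    from prefix_freeD[OF assms this] Cons.IH show ?case by (simp add: ys)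
  qed
  thus ?thesis unfolding prefix_free_def by blast
qed

definition code :: "nat list list \<Rightarrow> bool list" where
  "code = code_list (code_list code_nat)"

lemma code_inject: "code xs = code ys \<longleftrightarrow> xs = ys"
  using prefix_freeD[OF prefix_free_code_list[OF prefix_free_code_list[OF prefix_free_code_nat]], of xs "[]" ys "[]"]
  by (auto simp: code_def)

text \<open>Keeps the empty bit string free as the memory of the trivial case.\<close>

lemma code_not_Nil: "code xs \<noteq> []"
  by (simp add: code_def code_list_def)

lemma length_code_nat: "m < 2 ^ b \<Longrightarrow> length (code_nat m) \<le> 2 * b + 1"
proof (induction b arbitrary: m)
  case 0
  thus ?case by (simp add: code_nat.simps)
next
  case (Suc b)
  have "m div 2 < 2 ^ b" using Suc.prems by simp
  from Suc.IH[OF this] show ?case by (simp add: code_nat.simps[of m])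
qed

text \<open>Share of one inner list in the total code length: a continuation bit per entry, and 2
  for the end of the inner list and its continuation bit in the outer list.\<close>

definition cost :: "nat list \<Rightarrow> nat" where
  "cost xs = (\<Sum>m\<leftarrow>xs. length (code_nat m) + 1) + 2"

lemma length_code: "length (code xss) = (\<Sum>xs\<leftarrow>xss. cost xs) + 1"
proof -
  have l: "length (code_list e xs) = (\<Sum>x\<leftarrow>xs. length (e x) + 1) + 1" for e :: "'b \<Rightarrow> bool list" and xs
    by (induction xs) (auto simp: code_list_def)
  have "length (code_list code_nat xs) + 1 = cost xs" for xs
    by (simp add: l cost_def)
  thus ?thesis by (simp add: code_def l)
qed

lemma cost_le:
  assumes "\<And>m. m \<in> set xs \<Longrightarrow> m < 2 ^ b" "length xs \<le> c"
  shows "cost xs \<le> c * (2 * b + 2) + 2"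
proof -
  have "(\<Sum>m\<leftarrow>xs. length (code_nat m) + 1) \<le> (\<Sum>m\<leftarrow>xs. 2 * b + 2)"
    using assms(1) length_code_nat by (intro sum_list_mono) fastforce
  also have "\<dots> = length xs * (2 * b + 2)" by (simp add: sum_list_triv)
  also have "\<dots> \<le> c * (2 * b + 2)" using assms(2) by (rule mult_le_mono1)
  finally show ?thesis by (simp add: cost_def)
qed

section \<open>Simulating per-vertex updates on the item stream\<close>

definition nbrs :: "nat pair_pre_digraph \<Rightarrow> nat \<Rightarrow> nat set" where
  "nbrs G v = {u. (v, u) \<in> parcs G}"

text \<open>The memory bound concerns every prefix of the run, also inside an adjacency list. This
  and the next two lemmas carry a property of all intermediate states through concatenation.\<close>

lemma foldl_take_append:
  assumes "\<forall>i. P (foldl f m (take i xs))" "\<forall>i. P (foldl f (foldl f m xs) (take i ys))"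
  shows "\<forall>i. P (foldl f m (take i (xs @ ys)))"
proof
  fix i show "P (foldl f m (take i (xs @ ys)))"
    using assms(1) assms(2)[rule_format, of "i - length xs"] by (cases "i \<le> length xs") auto
qed

lemma foldl_take_Cons:
  assumes "P m" "\<forall>i. P (foldl f (f m x) (take i xs))"
  shows "\<forall>i. P (foldl f m (take i (x # xs)))"
proof
  fix i show "P (foldl f m (take i (x # xs)))" using assms by (cases i) auto
qed

lemma foldl_take_append_last:
  assumes "\<forall>i. P (foldl f m (take i xs))" "P (f (foldl f m xs) x)"
  shows "\<forall>i. P (foldl f m (take i (xs @ [x])))"
proof (rule foldl_take_append[OF assms(1)])
  have "P (foldl f m xs)" using assms(1)[rule_format, of "length xs"] by simp
  thus "\<forall>i. P (foldl f (foldl f m xs) (take i [x]))" using assms(2) by (intro foldl_take_Cons) auto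
qed

text \<open>
  A streaming algorithm that acts once per vertex \<open>v\<close>, on the neighbours of \<open>v\<close> within a small set of
  watched vertices. The bits hold the state together with the current vertex and its watched
  neighbours seen so far. The empty memory is reserved for graphs on at most one vertex,
  where the bit budget may vanish and the answer is a constant.
\<close>

locale sketch =
  fixes init :: "nat set \<Rightarrow> 's" and watch :: "'s \<Rightarrow> nat set"
    and commit :: "'s \<Rightarrow> nat \<Rightarrow> nat set \<Rightarrow> 's" and pass_end :: "'s \<Rightarrow> 's"
    and out :: "'s \<Rightarrow> 'o option" and trivial :: 'o
    and flat :: "'s \<Rightarrow> nat list list" and valid :: "'s \<Rightarrow> bool"
  assumes inj_flat: "inj_on flat (Collect valid)"
    and valid_init: "finite X \<Longrightarrow> valid (init X)"
    and finite_watch: "valid s \<Longrightarrow> finite (watch s)"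
    and valid_commit: "valid s \<Longrightarrow> N \<subseteq> watch s \<Longrightarrow> valid (commit s v N)"
    and valid_pass_end: "valid s \<Longrightarrow> valid (pass_end s)"
begin

definition encode :: "'s \<times> (nat \<times> nat set) option \<Rightarrow> bool list" where
  "encode m = code ((case snd m of None \<Rightarrow> [] | Some (v, N) \<Rightarrow> v # sorted_list_of_set N) # flat (fst m))"

text \<open>The buffer stays within the finite watch set, and \<open>sorted_list_of_set\<close> is
  injective only on finite sets; this is what makes \<open>encode\<close> invertible.\<close>

definition ok :: "'s \<times> (nat \<times> nat set) option \<Rightarrow> bool" where
  "ok m \<longleftrightarrow> valid (fst m) \<and> (\<forall>v N. snd m = Some (v, N) \<longrightarrow> N \<subseteq> watch (fst m))"

lemma inj_encode: "inj_on encode (Collect ok)"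
proof (rule inj_onI)
  fix m m' assume ok: "m \<in> Collect ok" "m' \<in> Collect ok" and "encode m = encode m'"
  hence flat: "flat (fst m) = flat (fst m')"
    and buf: "(case snd m of None \<Rightarrow> [] | Some (v, N) \<Rightarrow> v # sorted_list_of_set N)
      = (case snd m' of None \<Rightarrow> [] | Some (v, N) \<Rightarrow> v # sorted_list_of_set N)"
    by (simp_all add: encode_def code_inject)
  have "valid (fst m)" "valid (fst m')" using ok by (simp_all add: ok_def)
  with flat have 1: "fst m = fst m'" using inj_flat by (auto dest: inj_onD)
  have inject: "sorted_list_of_set A = sorted_list_of_set B \<longleftrightarrow> A = B" if "finite A" "finite B" for A B :: "nat set"
    using that sorted_list_of_set_inject by metis
  have fin: "finite N" if "ok m''" "snd m'' = Some (v, N)" for m'' v N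
    using that finite_watch[of "fst m''"] finite_subset[of N "watch (fst m'')"] by (simp add: ok_def)
  have "finite N" if "snd m = Some (v, N)" for v N using fin[of m] ok that by simp
  moreover have "finite N" if "snd m' = Some (v, N)" for v N using fin[of m'] ok that by simp
  ultimately have "snd m = snd m'"
    using buf by (cases "snd m"; cases "snd m'") (auto simp: inject)
  with 1 show "m = m'" by (rule prod_eqI)
qed

definition decode :: "bool list \<Rightarrow> 's \<times> (nat \<times> nat set) option" where
  "decode = inv_into (Collect ok) encode"

lemma decode_encode: "ok m \<Longrightarrow> decode (encode m) = m"
  unfolding decode_def using inj_encode by (simp add: inv_into_f_f)

text \<open>An adjacency list is known to be complete only when the next vertex or the end of the
  pass arrives, so the update for a vertex is delayed until then.\<close>

definition flush :: "'s \<times> (nat \<times> nat set) option \<Rightarrow> 's" where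
  "flush m = (case snd m of None \<Rightarrow> fst m | Some (v, N) \<Rightarrow> commit (fst m) v N)"

fun astep :: "'s \<times> (nat \<times> nat set) option \<Rightarrow> al_item \<Rightarrow> 's \<times> (nat \<times> nat set) option" where
  "astep m (Vertex v) = (flush m, Some (v, {}))"
| "astep m (Edge _ u) =
    (fst m, map_option (\<lambda>(v, N). (v, if u \<in> watch (fst m) then insert u N else N)) (snd m))"
| "astep m Pass_End = (pass_end (flush m), None)"

lemma ok_astep:
  assumes "ok m" shows "ok (astep m x)"
proof -
  have "valid (flush m)"
    using assms valid_commit by (auto simp: ok_def flush_def split: option.split)
  thus ?thesis using assms valid_pass_end by (cases x; cases "snd m") (auto simp: ok_def split: if_splits)
qed

definition alg :: "'o streaming_alg" where
  "alg = \<lparr>init_mem = (\<lambda>n X. if n < 2 then [] else encode (init X, None)),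
          step = (\<lambda>m x. if m = [] then [] else encode (astep (decode m) x)),
          result = (\<lambda>m. if m = [] then Some trivial else out (fst (decode m)))\<rparr>"

lemma encode_not_Nil: "encode m \<noteq> []"
  by (simp add: encode_def code_not_Nil)

lemma foldl_step: "ok m \<Longrightarrow> foldl (step alg) (encode m) xs = encode (foldl astep m xs) \<and> ok (foldl astep m xs)"
proof (induction xs arbitrary: m)
  case (Cons x xs)
  thus ?case using ok_astep[of m x] by (simp add: alg_def encode_not_Nil decode_encode)
qed simp

lemma outputs_trivial:
  assumes "n < 2" "0 \<le> p" "0 \<le> b" shows "outputs_within alg n X \<sigma> trivial p b"
proof -
  have "foldl (step alg) [] xs = []" for xs by (induction xs) (auto simp: alg_def)
  thus ?thesis unfolding outputs_within_def mem_after_def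
    using assms by (intro exI[of _ 0]) (auto simp: alg_def passes_def)
qed

text \<open>The effect of one pass without items and buffer; the order within the adjacency lists
  has disappeared.\<close>

definition scan :: "nat pair_pre_digraph \<Rightarrow> 's \<Rightarrow> nat list \<Rightarrow> 's" where
  "scan G s vs = foldl (\<lambda>s v. commit s v (nbrs G v \<inter> watch s)) s vs"

lemma scan_simps [simp]:
  "scan G s [] = s" "scan G s (v # vs) = scan G (commit s v (nbrs G v \<inter> watch s)) vs"
  "scan G s (vs @ ws) = scan G (scan G s vs) ws"
  by (simp_all add: scan_def)

lemma astep_edges:
  "foldl astep (s, Some (v, N)) (map (Edge v) us) = (s, Some (v, N \<union> (set us \<inter> watch s)))"
  by (induction us arbitrary: N) auto

text \<open>The interface used by both algorithms: correctness becomes a statement about iterated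
  \<open>scan\<close> for an arbitrary vertex order, and the memory bound one about states
  satisfying an invariant \<open>I\<close>, with or without a buffer.\<close>

lemma outputs_withinI:
  fixes G :: "nat pair_pre_digraph"
  assumes n: "2 \<le> n" and X: "finite X" and stream: "al_stream G \<sigma>"
    and inv_init: "I (init X)"
    and inv_commit: "\<And>s v. I s \<Longrightarrow> v \<in> pverts G \<Longrightarrow> I (commit s v (nbrs G v \<inter> watch s))"
    and inv_pass_end: "\<And>s. I s \<Longrightarrow> I (pass_end s)"
    and bits: "\<And>s. I s \<Longrightarrow> real (length (encode (s, None))) \<le> b"
      "\<And>s v N. I s \<Longrightarrow> v \<in> pverts G \<Longrightarrow> N \<subseteq> nbrs G v \<inter> watch s \<Longrightarrow> real (length (encode (s, Some (v, N)))) \<le> b"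
    and run: "\<And>vs. set vs = pverts G \<Longrightarrow> \<exists>p. real p \<le> max_p \<and>
      (\<forall>q<p. out (((\<lambda>s. pass_end (scan G s vs)) ^^ q) (init X)) = None) \<and>
      out (((\<lambda>s. pass_end (scan G s vs)) ^^ p) (init X)) = Some ans"
  shows "outputs_within alg n X \<sigma> ans max_p b"
proof -
  obtain vs nb where vs: "set vs = pverts G"
    and nb': "\<forall>v\<in>pverts G. distinct (nb v) \<and> set (nb v) = {u. (v, u) \<in> parcs G}"
    and \<sigma>: "\<sigma> = concat (map (\<lambda>v. Vertex v # map (Edge v) (nb v)) vs)"
    using stream unfolding al_stream_def by blast
  have nb: "set (nb v) = nbrs G v" if "v \<in> pverts G" for v
    using nb' that by (simp add: nbrs_def)
  \<comment> \<open>Only an inclusion for the buffered neighbours, since in the middle of a list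
    some of them are still to come.\<close>
  define good where "good m \<longleftrightarrow> I (fst m) \<and>
    (\<forall>v N. snd m = Some (v, N) \<longrightarrow> v \<in> pverts G \<and> N \<subseteq> nbrs G v \<inter> watch (fst m))" for m
  have good_bits: "real (length (encode m)) \<le> b" if "good m" for m
    using that bits(1)[of "fst m"] bits(2)[of "fst m"]
    by (cases m; cases "snd m") (auto simp: good_def)
  \<comment> \<open>Compared after \<open>flush\<close>, because the last vertex is still buffered
    when its list ends.\<close>
  have block: "(\<forall>i. good (foldl astep m (take i (concat (map (\<lambda>v. Vertex v # map (Edge v) (nb v)) ws)))))
      \<and> flush (foldl astep m (concat (map (\<lambda>v. Vertex v # map (Edge v) (nb v)) ws))) = scan G (flush m) ws"
    if "good m" "I (flush m)" "set ws \<subseteq> pverts G" for m ws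
    using that
  proof (induction ws arbitrary: m)
    case Nil
    thus ?case by simp
  next
    case (Cons w ws)
    let ?m = "(flush m, Some (w, nbrs G w \<inter> watch (flush m)))"
    have w: "w \<in> pverts G" using Cons.prems by simp
    have end_w: "foldl astep (astep m (Vertex w)) (map (Edge w) (nb w)) = ?m"
      by (simp add: astep_edges nb[OF w])
    have good_w: "\<forall>i. good (foldl astep (astep m (Vertex w)) (take i (map (Edge w) (nb w))))"
      using Cons.prems w set_take_subset[of _ "nb w"] nb[OF w]
      by (auto simp: take_map astep_edges good_def)
    have fl: "flush ?m = commit (flush m) w (nbrs G w \<inter> watch (flush m))"
      by (simp add: flush_def)
    have "good ?m" using Cons.prems w by (simp add: good_def)
    moreover have "I (flush ?m)" unfolding fl using Cons.prems w inv_commit by simp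
    ultimately have IH:
      "\<forall>i. good (foldl astep ?m (take i (concat (map (\<lambda>v. Vertex v # map (Edge v) (nb v)) ws))))"
      "flush (foldl astep ?m (concat (map (\<lambda>v. Vertex v # map (Edge v) (nb v)) ws))) = scan G (flush ?m) ws"
      using Cons.IH Cons.prems by simp_all
    have "\<forall>i. good (foldl astep m (take i ((Vertex w # map (Edge w) (nb w)) @
        concat (map (\<lambda>v. Vertex v # map (Edge v) (nb v)) ws))))"
    proof (rule foldl_take_append)
      show "\<forall>i. good (foldl astep m (take i (Vertex w # map (Edge w) (nb w))))"
        using Cons.prems good_w by (intro foldl_take_Cons)
      show "\<forall>i. good (foldl astep (foldl astep m (Vertex w # map (Edge w) (nb w)))
          (take i (concat (map (\<lambda>v. Vertex v # map (Edge v) (nb v)) ws))))"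
        using IH(1) end_w by simp
    qed
    thus ?case using IH(2) end_w fl by simp
  qed
  have inv_scan: "I (scan G s ws)" if "I s" "set ws \<subseteq> pverts G" for s ws
    using that by (induction ws arbitrary: s) (auto intro: inv_commit)
  have pass: "(\<forall>i. good (foldl astep (s, None) (take i (\<sigma> @ [Pass_End]))))
      \<and> foldl astep (s, None) (\<sigma> @ [Pass_End]) = (pass_end (scan G s vs), None)"
    if "I s" for s
  proof -
    have 1: "\<forall>i. good (foldl astep (s, None) (take i \<sigma>))" and 2: "flush (foldl astep (s, None) \<sigma>) = scan G s vs"
      using block[of "(s, None)" vs] that vs by (auto simp: \<sigma> good_def flush_def)
    have 3: "astep (foldl astep (s, None) \<sigma>) Pass_End = (pass_end (scan G s vs), None)"
      using 2 by simp
    have "good (pass_end (scan G s vs), None)"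
      using that inv_scan inv_pass_end vs by (simp add: good_def)
    hence "\<forall>i. good (foldl astep (s, None) (take i (\<sigma> @ [Pass_End])))"
      using 1 3 by (intro foldl_take_append_last) simp_all
    thus ?thesis using 3 by simp
  qed
  have passes: "(\<forall>i. good (foldl astep (s, None) (take i (passes q \<sigma>))))
      \<and> foldl astep (s, None) (passes q \<sigma>) = (((\<lambda>s. pass_end (scan G s vs)) ^^ q) s, None)"
    if "I s" for s q
    using that
  proof (induction q arbitrary: s)
    case 0
    thus ?case by (simp add: passes_def good_def)
  next
    case (Suc q)
    have s': "I (pass_end (scan G s vs))" using Suc.prems inv_scan inv_pass_end vs by simp
    have eq: "passes (Suc q) \<sigma> = (\<sigma> @ [Pass_End]) @ passes q \<sigma>" by (simp add: passes_def)
    have "\<forall>i. good (foldl astep (s, None) (take i (passes (Suc q) \<sigma>)))"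
      unfolding eq using pass[OF Suc.prems] Suc.IH[OF s']
      by (intro foldl_take_append[of _ _ _ "\<sigma> @ [Pass_End]"]) (simp_all del: foldl_append take_append)
    thus ?case unfolding eq using pass[OF Suc.prems] Suc.IH[OF s']
      funpow_swap1[of "\<lambda>s. pass_end (scan G s vs)" q s] by simp
  qed
  have ok: "ok (init X, None)" using X valid_init by (simp add: ok_def)
  have mem: "mem_after alg n X xs = encode (foldl astep (init X, None) xs) \<and> ok (foldl astep (init X, None) xs)" for xs
    using foldl_step[OF ok, of xs] n by (simp add: mem_after_def alg_def)
  have res: "result alg (mem_after alg n X (passes q \<sigma>)) = out (((\<lambda>s. pass_end (scan G s vs)) ^^ q) (init X))" for q
    using mem[of "passes q \<sigma>"] passes[OF inv_init, of q] decode_encode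
    by (simp add: alg_def encode_not_Nil)
  obtain p where p: "real p \<le> max_p"
    "\<forall>q<p. out (((\<lambda>s. pass_end (scan G s vs)) ^^ q) (init X)) = None"
    "out (((\<lambda>s. pass_end (scan G s vs)) ^^ p) (init X)) = Some ans"
    using run[OF vs] by blast
  show ?thesis unfolding outputs_within_def
  proof (intro exI[of _ p] conjI allI impI)
    show "real (length (mem_after alg n X (take i (passes p \<sigma>)))) \<le> b" for i
      using mem passes[OF inv_init, of p] good_bits by simp
  qed (use p res in auto)
qed

end

section \<open>Classes of vertices and the one-pass algorithm\<close>

text \<open>Greedy independent set of \<open>G - X\<close>: the first vertex met in each clique
  becomes its representative.\<close>

definition add_rep :: "nat set \<Rightarrow> nat set \<Rightarrow> nat \<Rightarrow> nat set \<Rightarrow> nat set" where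
  "add_rep X R v N = (if v \<in> X \<or> N \<inter> R \<noteq> {} then R else insert v R)"

text \<open>Vertices of \<open>X\<close> label themselves, so that \<open>X \<union> R\<close>
  indexes modulator vertices and cliques alike. The choice is unambiguous by
  \<open>is_lab_unique\<close>.\<close>

definition lab :: "nat set \<Rightarrow> nat set \<Rightarrow> nat \<Rightarrow> nat set \<Rightarrow> nat" where
  "lab X R v N = (if v \<in> X \<union> R then v else (SOME r. r \<in> N \<inter> R))"

context clique_modulator_graph
begin

lemma mem_nbrs: "u \<in> nbrs G v \<longleftrightarrow> (v, u) \<in> parcs G"
  by (simp add: nbrs_def)

definition rep_set :: "nat set \<Rightarrow> bool" where
  "rep_set R \<longleftrightarrow> R \<subseteq> pverts G - X \<and> R \<times> R \<inter> parcs G = {}"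

text \<open>A relational counterpart of \<open>lab\<close> that is monotone in \<open>R\<close>:
  labels given early survive when representatives are added.\<close>

definition is_lab :: "nat set \<Rightarrow> nat \<Rightarrow> nat \<Rightarrow> bool" where
  "is_lab R v r \<longleftrightarrow> r \<in> R \<and> (r = v \<or> (v, r) \<in> parcs G)"

lemma rep_set_empty: "rep_set {}"
  by (simp add: rep_set_def)

text \<open>Two representatives next to the same vertex outside \<open>X\<close> would be adjacent
  by transitivity, against independence.\<close>

lemma is_lab_unique:
  assumes R: "rep_set R" and v: "v \<notin> X" and r: "is_lab R v r" "is_lab R v r'" shows "r = r'"
proof (rule ccontr)
  assume "r \<noteq> r'"
  moreover have "r \<notin> X" "r' \<notin> X" using R r by (auto simp: rep_set_def is_lab_def)
  ultimately have "(r, r') \<in> parcs G"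
    using r v E_sym clique_trans[of r v r'] by (auto simp: is_lab_def)
  thus False using R r by (auto simp: rep_set_def is_lab_def)
qed

lemma rep_set_add_rep:
  assumes "rep_set R" "v \<in> pverts G" shows "rep_set (add_rep X R v (nbrs G v \<inter> (X \<union> R)))"
proof (cases "v \<in> X \<or> nbrs G v \<inter> (X \<union> R) \<inter> R \<noteq> {}")
  case False
  hence "(v, r) \<notin> parcs G" if "r \<in> R" for r using that by (auto simp: mem_nbrs)
  moreover from this have "(r, v) \<notin> parcs G" if "r \<in> R" for r using that E_sym by blast
  ultimately show ?thesis using assms False E_irrefl by (auto simp: rep_set_def add_rep_def)
qed (use assms in \<open>auto simp: add_rep_def\<close>)

text \<open>The neighbours of \<open>v\<close> are filtered through the old set \<open>R'\<close>,
  before \<open>v\<close> itself may join. As \<open>R\<close> exceeds \<open>R'\<close> by at most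
  \<open>v\<close>, no representative among the neighbours is lost.\<close>

lemma is_lab_lab:
  assumes "is_lab R v r" "v \<notin> X" "R \<subseteq> insert v R'"
  shows "is_lab R v (lab X R v (nbrs G v \<inter> (X \<union> R')))"
proof (cases "v \<in> R")
  case False
  hence "r \<in> (nbrs G v \<inter> (X \<union> R')) \<inter> R" using assms by (auto simp: is_lab_def mem_nbrs)
  hence "(SOME r. r \<in> (nbrs G v \<inter> (X \<union> R')) \<inter> R) \<in> (nbrs G v \<inter> (X \<union> R')) \<inter> R" by (rule someI)
  thus ?thesis using False assms(2) by (auto simp: lab_def is_lab_def mem_nbrs)
qed (simp add: lab_def is_lab_def)

lemma is_lab_add_rep:
  "v \<notin> X \<Longrightarrow> \<exists>r. is_lab (add_rep X R v (nbrs G v \<inter> (X \<union> R))) v r"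
  by (auto simp: is_lab_def add_rep_def mem_nbrs)

end

section \<open>Complete sets of representatives, and graphs with the same classes\<close>

locale represented = clique_modulator_graph +
  fixes R
  assumes rep_set_R: "rep_set R"
    and covered: "v \<in> pverts G \<Longrightarrow> v \<notin> X \<Longrightarrow> \<exists>r. is_lab R v r"
begin

definition label :: "nat \<Rightarrow> nat" where
  "label v = lab X R v (nbrs G v \<inter> (X \<union> R))"

text \<open>A vertex of \<open>X\<close> is alone in its class, as \<open>label\<close> fixes
  \<open>X\<close> and sends the other vertices into \<open>R\<close>. Class-preserving maps are
  therefore the identity on \<open>X\<close>.\<close>

definition cls :: "nat \<Rightarrow> nat \<times> nat set" where
  "cls v = (label v, nbrs G v \<inter> X)"

lemma label_X [simp]: "v \<in> X \<Longrightarrow> label v = v"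
  by (simp add: label_def lab_def)

lemma is_lab_label: "v \<in> pverts G \<Longrightarrow> v \<notin> X \<Longrightarrow> is_lab R v (label v)"
  unfolding label_def using covered is_lab_lab by blast

lemma label_eqI: "v \<in> pverts G \<Longrightarrow> v \<notin> X \<Longrightarrow> is_lab R v r \<Longrightarrow> label v = r"
  using is_lab_label is_lab_unique[OF rep_set_R] by blast

lemma label_R: "v \<in> pverts G \<Longrightarrow> v \<notin> X \<Longrightarrow> label v \<in> R"
  using is_lab_label by (simp add: is_lab_def)

lemma R_X: "r \<in> R \<Longrightarrow> r \<in> pverts G \<and> r \<notin> X"
  using rep_set_R by (auto simp: rep_set_def)

lemma label_rep [simp]: "r \<in> R \<Longrightarrow> label r = r"
  by (simp add: label_def lab_def)

lemma label_in_X_iff: "v \<in> pverts G \<Longrightarrow> label v \<in> X \<longleftrightarrow> v \<in> X"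
  using label_R R_X label_X by metis

lemma label_eq_iff:
  assumes "u \<in> pverts G" "v \<in> pverts G" "u \<notin> X" "v \<notin> X"
  shows "label u = label v \<longleftrightarrow> u = v \<or> (u, v) \<in> parcs G"
proof
  assume eq: "label u = label v"
  have 1: "label u = u \<or> (u, label u) \<in> parcs G" "label v = v \<or> (v, label v) \<in> parcs G"
    using is_lab_label assms by (auto simp: is_lab_def)
  have 2: "label u \<notin> X" using label_in_X_iff assms by blast
  show "u = v \<or> (u, v) \<in> parcs G"
    using 1 2 eq E_sym clique_trans[of u "label u" v] assms by metis
next
  assume adj: "u = v \<or> (u, v) \<in> parcs G"
  have "is_lab R u (label v)" if uv: "(u, v) \<in> parcs G"
  proof -
    have lv: "label v \<in> R" "label v = v \<or> (v, label v) \<in> parcs G"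
      using is_lab_label assms by (auto simp: is_lab_def)
    thus ?thesis using clique_trans[OF uv, of "label v"] uv assms R_X by (auto simp: is_lab_def)
  qed
  thus "label u = label v" using adj label_eqI assms by blast
qed

lemma cdist_same_label: "u \<in> pverts G \<Longrightarrow> v \<in> pverts G \<Longrightarrow> label u = label v \<Longrightarrow> cdist u v \<le> 1"
proof -
  assume uv: "u \<in> pverts G" "v \<in> pverts G" and eq: "label u = label v"
  have "u = v \<or> (u, v) \<in> parcs G"
    using eq label_eq_iff[OF uv] label_in_X_iff uv label_X by metis
  thus ?thesis using cdist_step[of u v u] cdist_self by auto
qed

end

text \<open>The map between the graphs must hit both given endpoints. An arbitrary class-preserving
  map is redefined at preimages of \<open>u'\<close> and \<open>v'\<close>, which is consistent
  since their classes differ; endpoints of equal class are at distance at most 1, whence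
  \<open>max 1\<close>.\<close>

lemma represented_cdist_le:
  assumes "represented G X R" "represented G' X R"
    and cls: "represented.cls G X R ` pverts G = represented.cls G' X R ` pverts G'"
    and uv: "u' \<in> pverts G'" "v' \<in> pverts G'"
  shows "clique_modulator.cdist (parcs G') X u' v' \<le> max 1 (clique_modulator.ecc_max (pverts G) (parcs G) X)"
proof -
  interpret A: represented G X R by fact
  interpret B: represented G' X R by fact
  show ?thesis
  proof (cases "B.cls u' = B.cls v'")
    case True
    thus ?thesis using B.cdist_same_label uv by (simp add: B.cls_def le_max_iff_disj)
  next
    case False
    have pre: "\<exists>w\<in>pverts G. A.cls w = B.cls w'" if "w' \<in> pverts G'" for w'
    proof -
      have "B.cls w' \<in> A.cls ` pverts G" unfolding cls using that by (rule imageI)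
      thus ?thesis by auto
    qed
    obtain u v where u: "u \<in> pverts G" "A.cls u = B.cls u'" and v: "v \<in> pverts G" "A.cls v = B.cls v'"
      using pre[OF uv(1)] pre[OF uv(2)] by blast
    have "\<exists>w'\<in>pverts G'. B.cls w' = A.cls w" if "w \<in> pverts G" for w
    proof -
      have "A.cls w \<in> B.cls ` pverts G'" unfolding cls[symmetric] using that by (rule imageI)
      thus ?thesis by auto
    qed
    then obtain h where h: "\<And>w. w \<in> pverts G \<Longrightarrow> h w \<in> pverts G' \<and> B.cls (h w) = A.cls w" by metis
    define g where "g = h(u := u', v := v')"
    have gu: "g u = u'" and gv: "g v = v'" using u v False by (auto simp: g_def)
    have g: "g w \<in> pverts G'" "B.label (g w) = A.label w" "nbrs G' (g w) \<inter> X = nbrs G w \<inter> X"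
      if "w \<in> pverts G" for w
      using h[OF that] u v uv by (auto simp: g_def A.cls_def B.cls_def)
    have gX: "g w \<in> X \<longleftrightarrow> w \<in> X" if "w \<in> pverts G" for w
      using g[OF that] A.label_in_X_iff[OF that] B.label_in_X_iff[of "g w"] by simp
    have gX_id: "g w = w" if "w \<in> pverts G" "w \<in> X" for w
      using g(2)[OF that(1)] gX[OF that(1)] that by simp
    have to_X: "(g a, g b) \<in> parcs G'" if "(a, b) \<in> parcs G" "b \<in> X" for a b
    proof -
      have ab: "a \<in> pverts G" "b \<in> pverts G" using that A.E_in_V by auto
      have "b \<in> nbrs G a \<inter> X" using that by (simp add: A.mem_nbrs)
      hence "b \<in> nbrs G' (g a)" using g(3)[OF ab(1)] by blast
      thus ?thesis using gX_id[OF ab(2) that(2)] by (simp add: B.mem_nbrs)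
    qed
    \<comment> \<open>Edges at \<open>X\<close> are recorded in the classes, the others join equal
      labels. Since \<open>g\<close> may merge two vertices of a clique, walks can become
      shorter.\<close>
    have edge: "g a = g b \<or> (g a, g b) \<in> parcs G'" if ab: "(a, b) \<in> parcs G" for a b
    proof (cases "a \<in> X \<or> b \<in> X")
      case True
      thus ?thesis using to_X[OF ab] to_X[OF A.E_sym[OF ab]] B.E_sym by blast
    next
      case False
      have V: "a \<in> pverts G" "b \<in> pverts G" using ab A.E_in_V by auto
      have "A.label a = A.label b" using A.label_eq_iff V False ab by blast
      thus ?thesis using B.label_eq_iff[of "g a" "g b"] g V gX False by auto
    qed
    have walk: "\<exists>m'\<le>m. (g a, g b) \<in> parcs G' ^^ m'" if "(a, b) \<in> parcs G ^^ m" for a b m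
      using that
    proof (induction m arbitrary: b)
      case (Suc m)
      then obtain c where "(a, c) \<in> parcs G ^^ m" and cb: "(c, b) \<in> parcs G" by auto
      then obtain m' where m': "m' \<le> m" "(g a, g c) \<in> parcs G' ^^ m'" using Suc.IH by blast
      show ?case
      proof (cases "g c = g b")
        case True
        thus ?thesis using m' by (intro exI[of _ m']) simp
      next
        case False
        hence "(g a, g b) \<in> parcs G' ^^ Suc m'" using edge[OF cb] m' by auto
        thus ?thesis using m' by (intro exI[of _ "Suc m'"]) simp
      qed
    qed simp
    have "B.cdist u' v' \<le> A.cdist u v"
    proof (cases "(u, v) \<in> (parcs G)\<^sup>*")
      case True
      then obtain m where "m \<le> A.dist u v" "(u', v') \<in> parcs G' ^^ m"
        using walk[OF A.dist_relpow[OF True]] gu gv by auto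
      thus ?thesis using B.cdist_le_relpow[of u' v' m] True by (simp add: A.cdist_def)
    next
      case False
      \<comment> \<open>Both graphs share \<open>X\<close> and hence the value that stands for
        infinity.\<close>
      thus ?thesis using B.cdist_le_cap[of u' v'] by (simp add: A.cdist_def A.cap_def B.cap_def)
    qed
    thus ?thesis using A.cdist_le_ecc_max[OF u(1) v(1)] by simp
  qed
qed

lemma represented_ecc_max_eq:
  assumes "represented G X R" "represented G' X R"
    and cls: "represented.cls G X R ` pverts G = represented.cls G' X R ` pverts G'"
    and card: "2 \<le> card (pverts G)" "2 \<le> card (pverts G')"
  shows "clique_modulator.ecc_max (pverts G) (parcs G) X = clique_modulator.ecc_max (pverts G') (parcs G') X"
proof -
  interpret A: represented G X R by fact
  interpret B: represented G' X R by fact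
  have "pverts G \<noteq> {}" "pverts G' \<noteq> {}" using card by auto
  then obtain u v u' v' where "A.ecc_max = A.cdist u v" "u \<in> pverts G" "v \<in> pverts G"
    "B.ecc_max = B.cdist u' v'" "u' \<in> pverts G'" "v' \<in> pverts G'"
    using A.ecc_max_attained B.ecc_max_attained by metis
  thus ?thesis
    using represented_cdist_le[OF assms(1,2) cls, of u' v'] represented_cdist_le[OF assms(2,1) cls[symmetric], of u v]
      A.ecc_max_ge_1 B.ecc_max_ge_1 card by linarith
qed

section \<open>The one-pass sketch\<close>

text \<open>\<open>types\<close> collects classes of vertices outside \<open>X\<close> only; those
  of \<open>X\<close> can be rebuilt from \<open>links\<close>.\<close>

record one_state =
  mods :: "nat set"
  reps :: "nat set"
  types :: "(nat \<times> nat set) set"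
  links :: "(nat \<times> nat) set"
  finished :: bool

definition one_commit :: "one_state \<Rightarrow> nat \<Rightarrow> nat set \<Rightarrow> one_state" where
  "one_commit s v N = (if v \<in> mods s then s\<lparr>links := links s \<union> {v} \<times> (N \<inter> mods s)\<rparr>
     else let R = add_rep (mods s) (reps s) v N
       in s\<lparr>reps := R, types := insert (lab (mods s) R v N, N \<inter> mods s) (types s)\<rparr>)"

text \<open>Unlimited computation: find any graph consistent with the sketch and take its value. By
  \<open>represented_ecc_max_eq\<close> all such graphs agree.\<close>

definition one_answer :: "one_state \<Rightarrow> nat" where
  "one_answer s = (SOME m. \<exists>G. represented G (mods s) (reps s) \<and> 2 \<le> card (pverts G) \<and>
     types s = represented.cls G (mods s) (reps s) ` (pverts G - mods s) \<and>
     links s = parcs G \<inter> mods s \<times> mods s \<and>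
     m = clique_modulator.ecc_max (pverts G) (parcs G) (mods s))"

definition one_out :: "one_state \<Rightarrow> ereal option" where
  "one_out s = (if finished s then Some (of_cap (3 * card (mods s) + 2) (one_answer s)) else None)"

definition one_valid :: "one_state \<Rightarrow> bool" where
  "one_valid s \<longleftrightarrow> finite (mods s) \<and> finite (reps s) \<and> types s \<subseteq> reps s \<times> Pow (mods s) \<and>
     links s \<subseteq> mods s \<times> mods s"

text \<open>Characteristic vectors cost a constant number of bits per possible class, whereas a list
  of the occurring classes would pay about k + log n bits for each. The stored sorted sets fix the
  order of the positions.\<close>

definition one_flat :: "one_state \<Rightarrow> nat list list" where
  "one_flat s = (let xs = sorted_list_of_set (mods s); rs = sorted_list_of_set (reps s) in
     [xs, rs,
      map (\<lambda>p. of_bool ((fst p, set (snd p)) \<in> types s)) (List.product rs (subseqs xs)),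
      map (\<lambda>e. of_bool (e \<in> links s)) (List.product xs xs),
      [of_bool (finished s)]])"

lemma set_eq_within: "A \<subseteq> C \<Longrightarrow> B \<subseteq> C \<Longrightarrow> (\<And>e. e \<in> C \<Longrightarrow> e \<in> A \<longleftrightarrow> e \<in> B) \<Longrightarrow> A = B"
  by blast

lemma inj_one_flat: "inj_on one_flat (Collect one_valid)"
proof (rule inj_onI)
  fix s s' assume "s \<in> Collect one_valid" "s' \<in> Collect one_valid" and eq: "one_flat s = one_flat s'"
  hence v: "one_valid s" "one_valid s'" by auto
  have fin: "finite (mods s)" "finite (reps s)" "finite (mods s')" "finite (reps s')"
    using v by (auto simp: one_valid_def)
  have "sorted_list_of_set (mods s) = sorted_list_of_set (mods s')"
    "sorted_list_of_set (reps s) = sorted_list_of_set (reps s')"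
    using eq by (simp_all add: one_flat_def Let_def)
  hence X: "mods s = mods s'" and R: "reps s = reps s'"
    using fin by (auto dest: sorted_list_of_set_inject)
  have Q: "(r, set S) \<in> types s \<longleftrightarrow> (r, set S) \<in> types s'"
    if "r \<in> reps s" "S \<in> set (subseqs (sorted_list_of_set (mods s)))" for r S
    using eq that fin by (auto simp: one_flat_def Let_def X R of_bool_eq_iff)
  have Q': "(r, S) \<in> types s \<longleftrightarrow> (r, S) \<in> types s'" if "r \<in> reps s" "S \<subseteq> mods s" for r S
  proof -
    have "S \<in> set ` set (subseqs (sorted_list_of_set (mods s)))"
      using that fin by (simp add: subseqs_powset)
    thus ?thesis using Q[OF that(1)] by auto
  qed
  have types: "types s \<subseteq> reps s \<times> Pow (mods s)" "types s' \<subseteq> reps s \<times> Pow (mods s)"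
    and links: "links s \<subseteq> mods s \<times> mods s" "links s' \<subseteq> mods s \<times> mods s"
    using v X R by (simp_all add: one_valid_def)
  have "types s = types s'" using types by (rule set_eq_within) (use Q' in auto)
  moreover have "links s = links s'" using links
    by (rule set_eq_within) (use eq fin in \<open>auto simp: one_flat_def Let_def X of_bool_eq_iff\<close>)
  moreover have "finished s = finished s'" using eq by (simp add: one_flat_def Let_def of_bool_eq_iff)
  ultimately show "s = s'" using X R by simp
qed

interpretation one: sketch "\<lambda>X. \<lparr>mods = X, reps = {}, types = {}, links = {}, finished = False\<rparr>"
  "\<lambda>s. mods s \<union> reps s" one_commit "\<lambda>s. s\<lparr>finished := True\<rparr>" one_out 0 one_flat one_valid
proof
  show "inj_on one_flat (Collect one_valid)" by (rule inj_one_flat)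
next
  fix s N v assume s: "one_valid s" and N: "N \<subseteq> mods s \<union> reps s"
  let ?R = "add_rep (mods s) (reps s) v N"
  have "lab (mods s) ?R v N \<in> ?R" if "v \<notin> mods s"
  proof (cases "v \<in> ?R")
    case False
    hence "N \<inter> ?R \<noteq> {}" using that by (auto simp: add_rep_def split: if_splits)
    hence "(SOME r. r \<in> N \<inter> ?R) \<in> N \<inter> ?R" by (rule some_in_eq[THEN iffD2])
    thus ?thesis using that False by (simp add: lab_def)
  qed (simp add: lab_def)
  moreover have "reps s \<subseteq> ?R" "finite ?R" using s by (auto simp: add_rep_def one_valid_def)
  ultimately show "one_valid (one_commit s v N)"
    using s by (auto simp: one_valid_def one_commit_def Let_def)
qed (auto simp: one_valid_def)

context clique_modulator_graph
begin

text \<open>\<open>U\<close> consists of the vertices committed so far. Stating \<open>types\<close>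
  through \<open>is_lab\<close> keeps it valid while \<open>reps\<close> grows.\<close>

definition one_inv :: "nat set \<Rightarrow> one_state \<Rightarrow> bool" where
  "one_inv U s \<longleftrightarrow> mods s = X \<and> rep_set (reps s) \<and> (\<forall>v\<in>U - X. \<exists>r. is_lab (reps s) v r) \<and>
     types s = {(r, nbrs G v \<inter> X) | v r. v \<in> U - X \<and> is_lab (reps s) v r} \<and>
     links s = parcs G \<inter> (U \<inter> X) \<times> X"

lemma one_inv_commit:
  assumes inv: "one_inv U s" and v: "v \<in> pverts G"
  shows "one_inv (insert v U) (one_commit s v (nbrs G v \<inter> (mods s \<union> reps s)))"
proof (cases "v \<in> X")
  case True
  have "v \<notin> U - X" "insert v U - X = U - X" using True by auto
  thus ?thesis using inv True by (auto simp: one_inv_def one_commit_def mem_nbrs)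
next
  case False
  define R where "R = reps s"
  define R' where "R' = add_rep X R v (nbrs G v \<inter> (X \<union> R))"
  have X: "mods s = X" and R: "rep_set R" and cov: "\<And>u. u \<in> U - X \<Longrightarrow> \<exists>r. is_lab R u r"
    and Q: "types s = {(r, nbrs G v \<inter> X) | v r. v \<in> U - X \<and> is_lab R v r}"
    and F: "links s = parcs G \<inter> (U \<inter> X) \<times> X"
    using inv by (auto simp: one_inv_def R_def)
  have R': "rep_set R'" using rep_set_add_rep[OF R v] by (simp add: R'_def)
  have sub: "R \<subseteq> R'" "R' \<subseteq> insert v R" by (auto simp: R'_def add_rep_def)
  have mono: "is_lab R u r \<Longrightarrow> is_lab R' u r" for u r using sub by (auto simp: is_lab_def)
  \<comment> \<open>A vertex labelled earlier keeps its label and, by uniqueness with respect to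
    \<open>R'\<close>, gains none from the new representative.\<close>
  have old: "is_lab R' u r \<longleftrightarrow> is_lab R u r" if u: "u \<in> U - X" for u r
    using cov[OF u] mono is_lab_unique[OF R', of u] u by blast
  have lv: "is_lab R' v (lab X R' v (nbrs G v \<inter> (X \<union> R)))"
    using is_lab_add_rep[OF False, of R] is_lab_lab[OF _ False, of R' _ R] sub(2) unfolding R'_def by blast
  have lv_iff: "is_lab R' v r \<longleftrightarrow> r = lab X R' v (nbrs G v \<inter> (X \<union> R))" for r
    using lv is_lab_unique[OF R' False] by blast
  have eqX: "nbrs G v \<inter> (X \<union> reps s) \<inter> X = nbrs G v \<inter> X" by blast
  have step: "one_commit s v (nbrs G v \<inter> (mods s \<union> reps s)) =
      s\<lparr>reps := R', types := insert (lab X R' v (nbrs G v \<inter> (X \<union> R)), nbrs G v \<inter> X) (types s)\<rparr>"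
    using False X eqX by (simp add: one_commit_def Let_def R'_def R_def)
  have "\<forall>u\<in>insert v U - X. \<exists>r. is_lab R' u r" using cov mono lv by blast
  moreover have "insert (lab X R' v (nbrs G v \<inter> (X \<union> R)), nbrs G v \<inter> X) (types s)
      = {(r, nbrs G u \<inter> X) | u r. u \<in> insert v U - X \<and> is_lab R' u r}"
    unfolding Q using old lv_iff False by (auto intro: exI[of _ v])
  moreover have "links s = parcs G \<inter> (insert v U \<inter> X) \<times> X" using F False by auto
  ultimately show ?thesis using X R' unfolding step one_inv_def by simp
qed

lemma one_inv_scan:
  assumes "one_inv U s" "set vs \<subseteq> pverts G" shows "one_inv (U \<union> set vs) (one.scan G s vs)"
  using assms
proof (induction vs arbitrary: U s)
  case (Cons v vs)
  have "one_inv (insert v U) (one_commit s v (nbrs G v \<inter> (mods s \<union> reps s)))"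
    using Cons.prems by (intro one_inv_commit) auto
  from Cons.IH[OF this] Cons.prems show ?case by simp
qed simp

lemma one_answer_eq:
  assumes inv: "one_inv (pverts G) s" and card: "2 \<le> card (pverts G)"
  shows "one_answer s = ecc_max"
proof -
  define R where "R = reps s"
  have X: "mods s = X" and R: "rep_set R" and cov: "\<And>v. v \<in> pverts G \<Longrightarrow> v \<notin> X \<Longrightarrow> \<exists>r. is_lab R v r"
    and Q: "types s = {(r, nbrs G v \<inter> X) | v r. v \<in> pverts G - X \<and> is_lab R v r}"
    and F: "links s = parcs G \<inter> X \<times> X"
    using inv X_V by (auto simp: one_inv_def R_def)
  interpret represented G X R using R cov by unfold_locales
  have Qc: "types s = cls ` (pverts G - X)"
    unfolding Q cls_def using is_lab_label label_eqI by blast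
  let ?P = "\<lambda>m. \<exists>G. represented G (mods s) (reps s) \<and> 2 \<le> card (pverts G) \<and>
     types s = represented.cls G (mods s) (reps s) ` (pverts G - mods s) \<and>
     links s = parcs G \<inter> mods s \<times> mods s \<and>
     m = clique_modulator.ecc_max (pverts G) (parcs G) (mods s)"
  \<comment> \<open>The class of \<open>x \<in> X\<close> is \<open>x\<close> with its row of the
    adjacency relation of \<open>H[X]\<close>, so \<open>types\<close> and \<open>links\<close>
    together determine all classes.\<close>
  have split: "represented.cls H X R ` pverts H
      = represented.cls H X R ` (pverts H - X) \<union> (\<lambda>x. (x, (parcs H \<inter> X \<times> X) `` {x})) ` X"
    if "represented H X R" for H
  proof -
    interpret H: represented H X R by fact
    have "H.cls ` pverts H = H.cls ` (pverts H - X) \<union> H.cls ` X" using H.X_V by blast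
    moreover have "H.cls ` X = (\<lambda>x. (x, (parcs H \<inter> X \<times> X) `` {x})) ` X"
      by (intro image_cong) (auto simp: H.cls_def H.mem_nbrs)
    ultimately show ?thesis by simp
  qed
  have ex: "?P ecc_max"
    using Qc F X R_def card represented_axioms by (intro exI[of _ G]) simp
  have uniq: "m = ecc_max" if m: "?P m" for m
  proof -
    obtain H where H: "represented H X R" "2 \<le> card (pverts H)"
      "types s = represented.cls H X R ` (pverts H - X)" "links s = parcs H \<inter> X \<times> X"
      "m = clique_modulator.ecc_max (pverts H) (parcs H) X"
      using m X R_def by auto
    have "represented.cls H X R ` pverts H = cls ` pverts G"
      using split[OF H(1)] split[OF represented_axioms] H(3,4) Qc F by metis
    thus ?thesis using represented_ecc_max_eq[OF H(1) represented_axioms] H(2,5) card by simp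
  qed
  show ?thesis unfolding one_answer_def using ex uniq by (rule some_equality)
qed

end

section \<open>Memory of the one-pass algorithm\<close>

text \<open>Hides the k^2 bits for \<open>G[X]\<close> in the term 2^k l. The factor 2 is due to k =
  3.\<close>

lemma power2_le_exp: "k ^ 2 \<le> 2 * (2::nat) ^ k"
proof (induction k rule: less_induct)
  case (less k)
  show ?case
  proof (cases "k \<le> 3")
    case True
    hence "k \<in> {0, 1, 2, 3}" by auto
    thus ?thesis by auto
  next
    case False
    define j where "j = k - 1"
    have k: "k = Suc j" "3 \<le> j" using False by (auto simp: j_def)
    have "3 * j \<le> j * j" using k(2) by (rule mult_le_mono1)
    hence "Suc (j + j) \<le> j * j" using k(2) by linarith
    hence "k ^ 2 \<le> 2 * j ^ 2" using k by (simp add: power2_eq_square)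
    also have "\<dots> \<le> 2 * (2 * 2 ^ j)" using less.IH[of j] k by simp
    finally show ?thesis by (simp add: k)
  qed
qed

text \<open>For two or more vertices the logarithm is at least 1, so rounding it up at most doubles
  it.\<close>

lemma bit_width:
  assumes "2 \<le> n"
  obtains B where "1 \<le> B" "n \<le> 2 ^ B" "real B \<le> 2 * log 2 (real n)"
proof -
  define B where "B = nat \<lceil>log 2 (real n)\<rceil>"
  have l: "1 \<le> log 2 (real n)" using assms by (simp add: le_log_iff)
  have B: "log 2 (real n) \<le> real B" "real B \<le> log 2 (real n) + 1"
    unfolding B_def using l by linarith+
  have "real n \<le> 2 powr real B" using B(1) assms by (simp add: log_le_iff)
  hence "real n \<le> real (2 ^ B)" by (simp add: powr_realpow)
  hence "n \<le> 2 ^ B" by (simp only: of_nat_le_iff)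
  moreover have "1 \<le> B" using l B by linarith
  ultimately show ?thesis using that B(2) l by force
qed

lemma cost_buffer:
  assumes "\<And>m. m \<in> insert v N \<Longrightarrow> m < 2 ^ b" "finite N" "card N \<le> c"
  shows "cost (v # sorted_list_of_set N) \<le> (c + 1) * (2 * b + 2) + 2"
  using assms by (intro cost_le) auto

lemma cost_bits: "length xs \<le> c \<Longrightarrow> cost (map (\<lambda>x. of_bool (P x)) xs) \<le> c * 4 + 2"
proof -
  assume "length xs \<le> c"
  hence "cost (map (\<lambda>x. of_bool (P x)) xs) \<le> c * (2 * 1 + 2) + 2"
    by (intro cost_le) (auto simp del: of_bool_eq simp: of_bool_def)
  thus ?thesis by simp
qed

lemma cost_Nil: "cost [] = 2"
  by (simp add: cost_def)

lemma one_bits: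
  assumes inst: "instance_of n k l G X" and n: "n \<le> 2 ^ B" "1 \<le> B"
    and X: "mods s = X" and R: "clique_modulator_graph.rep_set G X (reps s)"
    and buf: "buf = None \<or> (\<exists>v N. buf = Some (v, N) \<and> v \<in> pverts G \<and> N \<subseteq> X \<union> reps s)"
  shows "length (one.encode (s, buf)) \<le> 50 * (2 ^ k * l + (k + l) * B)"
proof -
  interpret clique_modulator_graph G X using inst by (rule instance_of_modulator)
  have V: "pverts G = {..<n}" "card X = k" "1 \<le> l" using inst unfolding instance_of_def by blast+
  have Rl: "card (reps s) \<le> l"
    using R inst by (intro instance_of_independent[OF inst]) (auto simp: rep_set_def)
  have RV: "reps s \<subseteq> pverts G" using R by (auto simp: rep_set_def)
  have fin: "finite X" "finite (reps s)" using finite_X RV finite_subset pair_finite_verts by blast+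
  have small: "m < 2 ^ B" if "m \<in> pverts G" for m using that V n by auto
  have c1: "cost (sorted_list_of_set X) \<le> k * (2 * B + 2) + 2"
    using small X_V fin V by (intro cost_le) auto
  have c2: "cost (sorted_list_of_set (reps s)) \<le> l * (2 * B + 2) + 2"
    using small RV fin Rl by (intro cost_le) auto
  have "length (List.product (sorted_list_of_set (reps s)) (subseqs (sorted_list_of_set X))) \<le> l * 2 ^ k"
    using Rl fin V by (simp add: length_subseqs)
  note c3 = cost_bits[OF this, of "\<lambda>p. (fst p, set (snd p)) \<in> types s"]
  have "length (List.product (sorted_list_of_set X) (sorted_list_of_set X)) \<le> k * k"
    using fin V by simp
  note c4 = cost_bits[OF this, of "\<lambda>e. e \<in> links s"]
  have c5: "cost [of_bool (finished s)] \<le> 1 * 4 + 2"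
    using cost_bits[of "[()]" 1 "\<lambda>_. finished s"] by simp
  have c6: "cost (case buf of None \<Rightarrow> [] | Some (v, N) \<Rightarrow> v # sorted_list_of_set N) \<le> (k + l + 1) * (2 * B + 2) + 2"
  proof (cases buf)
    case (Some p)
    then obtain v N where p: "buf = Some (v, N)" "v \<in> pverts G" "N \<subseteq> X \<union> reps s" using buf by auto
    have "card N \<le> card (X \<union> reps s)" using p fin by (intro card_mono) auto
    also have "\<dots> \<le> k + l" using card_Un_le[of X "reps s"] Rl V by simp
    finally have "card N \<le> k + l" .
    moreover have "finite N" using p fin finite_subset by blast
    moreover have "m < 2 ^ B" if "m \<in> insert v N" for m using that p small RV X_V by blast
    ultimately show ?thesis unfolding p option.case prod.case by (intro cost_buffer)
  qed (simp add: cost_Nil)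
  have "k * k \<le> 2 * 2 ^ k" using power2_le_exp[of k] by (simp add: power2_eq_square)
  also have "\<dots> \<le> 2 * 2 ^ k * l" using V by simp
  finally have kk: "k * k \<le> 2 * (2 ^ k * l)" by simp
  have ml: "k + l \<le> (k + l) * B" using n by simp
  have one: "1 \<le> 2 ^ k * l" using V by simp
  have "B \<le> (k + l) * B" using V by simp
  have "length (one.encode (s, buf)) \<le> (k + l + 1) * (2 * B + 2) + 2 + (k * (2 * B + 2) + 2) + (l * (2 * B + 2) + 2)
      + (l * 2 ^ k * 4 + 2) + (k * k * 4 + 2) + 6 + 1"
    unfolding one.encode_def length_code one_flat_def Let_def
    using c1 c2 c3 c4 c5 c6 by (simp add: X)
  also have "\<dots> = 4 * ((k + l) * B) + 4 * (k + l) + 2 * B + 19 + 4 * (2 ^ k * l) + 4 * (k * k)"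
    by (simp add: algebra_simps)
  also have "\<dots> \<le> 50 * (2 ^ k * l + (k + l) * B)"
  proof -
    \<comment> \<open>With \<open>p\<close> for 2^k l and \<open>q\<close> for (k+l)B the left side
      is at most 31p + 10q; 50 is a round value above both.\<close>
    have "4 * q + 4 * m + 2 * B + 19 + 4 * p + 4 * r \<le> 50 * p + 50 * q"
      if "r \<le> 2 * p" "m \<le> q" "1 \<le> p" "B \<le> q" for p q r m using that by linarith
    from this[OF kk ml one \<open>B \<le> (k + l) * B\<close>] show ?thesis
      unfolding distrib_left[of "50::nat"] .
  qed
  finally show ?thesis .
qed

lemma solvableI:
  assumes "\<And>n k l G X \<sigma>. instance_of n k l G X \<Longrightarrow> al_stream G \<sigma> \<Longrightarrow> outputs_within A n X \<sigma> (problem G) (p n k l) (b n k l)"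
  shows "solvable_with_clique_modulator problem p b"
  unfolding solvable_with_clique_modulator_def
  using assms unfolding instance_of_def by blast

text \<open>Justifies the constant answer 0 given from the empty memory.\<close>

lemma diameter_singleton:
  assumes "instance_of n k l G X" "n < 2" shows "diameter G = 0"
proof -
  interpret clique_modulator_graph G X using assms(1) by (rule instance_of_modulator)
  have "n = 1" using instance_of_n[OF assms(1)] assms unfolding instance_of_def by linarith
  hence "pverts G = {0}" using assms(1) unfolding instance_of_def by auto
  moreover from this have "ecc_max = 0" by (intro ecc_maxI[of _ 0 0]) (auto simp: cdist_self)
  ultimately show ?thesis using diameter_eq by (simp add: of_cap_def cap_def zero_ereal_def)
qed

lemma one_pass_outputs:
  assumes inst: "instance_of n k l G X" and stream: "al_stream G \<sigma>"
  shows "outputs_within one.alg n X \<sigma> (diameter G) 1 (100 * (2 ^ k * real l + real (k + l) * log 2 (real n)))"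
proof (cases "n < 2")
  case True
  have "1 \<le> n" using instance_of_n[OF inst] inst unfolding instance_of_def by linarith
  thus ?thesis using True diameter_singleton[OF inst] by (auto intro!: one.outputs_trivial)
next
  case False
  interpret clique_modulator_graph G X using inst by (rule instance_of_modulator)
  obtain B where B: "1 \<le> B" "n \<le> 2 ^ B" "real B \<le> 2 * log 2 (real n)"
    using bit_width False by (metis not_less)
  have V: "pverts G = {..<n}" using inst unfolding instance_of_def by blast
  have bits: "real (length (one.encode (s, buf))) \<le> 100 * (2 ^ k * real l + real (k + l) * log 2 (real n))"
    if "mods s = X" "rep_set (reps s)"
      "buf = None \<or> (\<exists>v N. buf = Some (v, N) \<and> v \<in> pverts G \<and> N \<subseteq> X \<union> reps s)" for s buf
  proof -
    have "real (length (one.encode (s, buf))) \<le> real (50 * (2 ^ k * l + (k + l) * B))"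
      using one_bits[OF inst B(2,1) that] by (rule of_nat_mono)
    also have "\<dots> = 50 * (2 ^ k * real l) + 50 * (real (k + l) * real B)" by (simp add: algebra_simps)
    \<comment> \<open>The doubling from \<open>bit_width\<close> turns the constant 50 into
      100.\<close>
    also have "\<dots> \<le> 50 * (2 ^ k * real l) + 50 * (real (k + l) * (2 * log 2 (real n)))"
      using B(3) by (intro add_left_mono mult_left_mono) auto
    also have "\<dots> \<le> 100 * (2 ^ k * real l + real (k + l) * log 2 (real n))" by (simp add: algebra_simps)
    finally show ?thesis .
  qed
  let ?init = "\<lparr>mods = X, reps = {}, types = {}, links = {}, finished = False\<rparr>"
  have final: "one_out ((one.scan G ?init vs)\<lparr>finished := True\<rparr>) = Some (diameter G)" if vs: "set vs = pverts G" for vs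
  proof -
    have "one_inv {} ?init" by (auto simp: one_inv_def rep_set_empty)
    hence inv: "one_inv (pverts G) (one.scan G ?init vs)" using one_inv_scan[of "{}" ?init vs] vs by simp
    hence inv': "one_inv (pverts G) ((one.scan G ?init vs)\<lparr>finished := True\<rparr>)" by (simp add: one_inv_def)
    have "2 \<le> card (pverts G)" "pverts G \<noteq> {}" using V False by (auto simp: lessThan_empty_iff)
    with one_answer_eq[OF inv'] diameter_eq inv' show ?thesis
      by (simp add: one_out_def cap_def one_inv_def)
  qed
  show ?thesis
  proof (rule one.outputs_withinI[where I = "\<lambda>s. mods s = X \<and> rep_set (reps s)"])
    show "mods (one_commit s v (nbrs G v \<inter> (mods s \<union> reps s))) = X \<and>
        rep_set (reps (one_commit s v (nbrs G v \<inter> (mods s \<union> reps s))))"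
      if "mods s = X \<and> rep_set (reps s)" "v \<in> pverts G" for s v
      using that rep_set_add_rep by (simp add: one_commit_def Let_def)
    show "\<exists>p. real p \<le> 1 \<and> (\<forall>q<p. one_out (((\<lambda>s. (one.scan G s vs)\<lparr>finished := True\<rparr>) ^^ q) ?init) = None) \<and>
        one_out (((\<lambda>s. (one.scan G s vs)\<lparr>finished := True\<rparr>) ^^ p) ?init) = Some (diameter G)"
      if "set vs = pverts G" for vs
      using final[OF that] by (intro exI[of _ 1]) (simp add: one_out_def)
  qed (use False finite_X stream bits in \<open>auto simp: rep_set_empty\<close>)
qed

section \<open>Breadth-first search in many passes\<close>

text \<open>An upper estimate for one vertex of clique \<open>z\<close> with neighbours
  \<open>N\<close> in \<open>X\<close>. The summand 1 after \<open>e z\<close> is paid because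
  another vertex of the clique may attain \<open>e z\<close>.\<close>

definition close_val :: "(nat \<Rightarrow> nat) \<Rightarrow> nat \<Rightarrow> nat set \<Rightarrow> nat" where
  "close_val e z N = Min (insert (e z + 1) ((\<lambda>x. e x + 1) ` N))"

text \<open>A committed vertex pushes through itself to its neighbours in \<open>X\<close> and pulls
  from them into its own label. Between two vertices of \<open>X\<close> the push is not sharp; the
  pull at the receiving vertex is.\<close>

definition relax :: "(nat \<Rightarrow> nat) \<Rightarrow> nat \<Rightarrow> nat set \<Rightarrow> nat \<Rightarrow> nat" where
  "relax e z N = (\<lambda>y. if y \<in> N then min (e y) (close_val e z N + 1)
     else if y = z then Min (insert (e z) ((\<lambda>x. e x + 1) ` N)) else e y)"

lemma Min_insert_image_mono:
  fixes a b :: nat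
  assumes "finite N" "a \<le> b" "\<And>x. x \<in> N \<Longrightarrow> f x \<le> g x"
  shows "Min (insert a (f ` N)) \<le> Min (insert b (g ` N))"
proof -
  have "Min (insert b (g ` N)) \<in> insert b (g ` N)" using assms(1) by (intro Min_in) auto
  thus ?thesis
  proof
    assume "Min (insert b (g ` N)) = b"
    moreover have "Min (insert a (f ` N)) \<le> a" using assms(1) by (intro Min_le) auto
    ultimately show ?thesis using assms(2) by linarith
  next
    assume "Min (insert b (g ` N)) \<in> g ` N"
    then obtain x where x: "x \<in> N" "Min (insert b (g ` N)) = g x" by auto
    have "Min (insert a (f ` N)) \<le> f x" using assms(1) x(1) by (intro Min_le) auto
    thus ?thesis using x(2) assms(3)[OF x(1)] by linarith
  qed
qed

lemma close_val_mono: "finite N \<Longrightarrow> e \<le> e' \<Longrightarrow> close_val e z N \<le> close_val e' z N"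
  unfolding close_val_def by (intro Min_insert_image_mono) (auto simp: le_fun_def)

lemma close_val_le: "finite N \<Longrightarrow> close_val e z N \<le> e z + 1"
  "finite N \<Longrightarrow> x \<in> N \<Longrightarrow> close_val e z N \<le> e x + 1"
  unfolding close_val_def by (auto intro: Min_le)

lemma close_val_cases:
  assumes "finite N"
  shows "close_val e z N = e z + 1 \<or> (\<exists>x\<in>N. close_val e z N = e x + 1)"
proof -
  have "close_val e z N \<in> insert (e z + 1) ((\<lambda>x. e x + 1) ` N)"
    unfolding close_val_def using assms by (intro Min_in) auto
  thus ?thesis by auto
qed

lemma relax_mono: "finite N \<Longrightarrow> e \<le> e' \<Longrightarrow> relax e z N \<le> relax e' z N"
  unfolding relax_def le_fun_def
  using close_val_mono[of N e e' z] Min_insert_image_mono[of N "e z" "e' z" "\<lambda>x. e x + 1" "\<lambda>x. e' x + 1"]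
  by (auto simp: le_fun_def min_le_iff_disj)

lemma relax_le: "finite N \<Longrightarrow> relax e z N \<le> e"
  unfolding relax_def le_fun_def by auto

lemma relax_self_le: "finite N \<Longrightarrow> x \<in> N \<Longrightarrow> z \<notin> N \<Longrightarrow> relax e z N z \<le> e x + 1"
  unfolding relax_def by (auto intro: Min_le)

lemma relax_self_cases:
  assumes "finite N" "z \<notin> N" shows "relax e z N z = e z \<or> (\<exists>x\<in>N. relax e z N z = e x + 1)"
proof -
  have "Min (insert (e z) ((\<lambda>x. e x + 1) ` N)) \<in> insert (e z) ((\<lambda>x. e x + 1) ` N)"
    using assms(1) by (intro Min_in) auto
  thus ?thesis using assms(2) by (auto simp: relax_def)
qed

text \<open>Updates act in place and in stream order. Monotone decreasing updates still end below
  each single update of the initial value, which is the form \<open>complete_Suc\<close> asks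
  for.\<close>

lemma foldl_descending:
  fixes f :: "'b \<Rightarrow> 'a::order \<Rightarrow> 'a"
  assumes mono: "\<And>v x y. x \<le> y \<Longrightarrow> f v x \<le> f v y" and dec: "\<And>v x. f v x \<le> x"
  shows "foldl (\<lambda>x v. f v x) x vs \<le> x" "v \<in> set vs \<Longrightarrow> foldl (\<lambda>x v. f v x) x vs \<le> f v x"
proof -
  show le: "foldl (\<lambda>x v. f v x) x vs \<le> x" for x vs
    by (induction vs arbitrary: x) (use dec order_trans in \<open>auto, blast\<close>)
  show "v \<in> set vs \<Longrightarrow> foldl (\<lambda>x v. f v x) x vs \<le> f v x"
  proof (induction vs arbitrary: x)
    case (Cons w vs)
    show ?case
    proof (cases "v = w")
      case True
      thus ?thesis using le[of "f w x" vs] by simp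
    next
      case False
      hence "foldl (\<lambda>x v. f v x) (f w x) vs \<le> f v (f w x)" using Cons by simp
      also have "\<dots> \<le> f v x" by (intro mono dec)
      finally show ?thesis by simp
    qed
  qed simp
qed

section \<open>Sources and estimates of a single search\<close>

definition sources :: "nat set \<Rightarrow> nat set \<Rightarrow> (nat \<times> nat list) list" where
  "sources X R = map (\<lambda>x. (x, [])) (sorted_list_of_set X) @
     List.product (sorted_list_of_set R) (subseqs (sorted_list_of_set X))"

text \<open>The neighbours of the source in \<open>X\<close> must be given 1 at the outset: pushing
  from the clique value 0 would yield only 2. The value 0 off \<open>X \<union> R\<close> is a
  default that makes the function recoverable from finitely many values.\<close>

definition start :: "nat set \<Rightarrow> nat set \<Rightarrow> nat \<times> nat list \<Rightarrow> nat \<Rightarrow> nat" where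
  "start X R src z = (if z \<notin> X \<union> R \<or> z = fst src then 0 else if z \<in> set (snd src) then 1 else 3 * card X + 2)"

lemma length_sources: "finite X \<Longrightarrow> length (sources X R) = card X + card R * 2 ^ card X"
  by (simp add: sources_def length_subseqs)

context represented
begin

lemma finite_nbrs_X: "finite (nbrs G v \<inter> X)"
  using finite_X by simp

lemma label_in: "v \<in> pverts G \<Longrightarrow> label v \<in> X \<union> R"
  using label_R label_X by (cases "v \<in> X") auto

lemma label_id: "z \<in> X \<union> R \<Longrightarrow> label z = z"
  by auto

lemma label_not_nbr: "v \<in> pverts G \<Longrightarrow> label v \<notin> nbrs G v \<inter> X"
  using label_in_X_iff[of v] E_irrefl by (auto simp: mem_nbrs)

definition relax_at :: "nat \<Rightarrow> (nat \<Rightarrow> nat) \<Rightarrow> nat \<Rightarrow> nat" where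
  "relax_at v e = relax e (label v) (nbrs G v \<inter> X)"

text \<open>Estimates never fall below the distance of the nearest vertex with the given label;
  \<open>complete\<close> is the opposite inequality for vertices within radius
  \<open>t\<close>.\<close>

definition sound :: "nat \<Rightarrow> (nat \<Rightarrow> nat) \<Rightarrow> bool" where
  "sound s e \<longleftrightarrow> (\<forall>z\<in>X \<union> R. \<exists>v\<in>pverts G. label v = z \<and> cdist s v \<le> e z)"

definition complete :: "nat \<Rightarrow> nat \<Rightarrow> (nat \<Rightarrow> nat) \<Rightarrow> bool" where
  "complete s t e \<longleftrightarrow> (\<forall>v\<in>pverts G. cdist s v \<le> t \<longrightarrow> e (label v) \<le> cdist s v)"

text \<open>The second part remembers the initial value 1 next to the source, for the first step out
  of the source's clique in \<open>complete_Suc\<close>.\<close>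

definition bounded :: "nat \<Rightarrow> (nat \<Rightarrow> nat) \<Rightarrow> bool" where
  "bounded s e \<longleftrightarrow> (\<forall>z. e z \<le> cap) \<and> (s \<notin> X \<longrightarrow> (\<forall>x\<in>nbrs G s \<inter> X. e x \<le> 1))"

lemma sound_X: "sound s e \<Longrightarrow> x \<in> X \<Longrightarrow> cdist s x \<le> e x"
  unfolding sound_def using label_in_X_iff label_X by (metis UnI1)

lemma cdist_clique: "u \<in> pverts G \<Longrightarrow> v \<in> pverts G \<Longrightarrow> label u = label v \<Longrightarrow> cdist s v \<le> cdist s u + 1"
proof -
  assume uv: "u \<in> pverts G" "v \<in> pverts G" and eq: "label u = label v"
  have "u = v \<or> (u, v) \<in> parcs G"
    using eq label_eq_iff[OF uv] label_in_X_iff uv label_X by metis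
  thus ?thesis using cdist_step[of u v s] by auto
qed

lemma close_val_sound:
  assumes "sound s e" "v \<in> pverts G" shows "cdist s v \<le> close_val e (label v) (nbrs G v \<inter> X)"
  using close_val_cases[OF finite_nbrs_X]
proof
  assume eq: "close_val e (label v) (nbrs G v \<inter> X) = e (label v) + 1"
  obtain u where "u \<in> pverts G" "label u = label v" "cdist s u \<le> e (label v)"
    using assms label_in unfolding sound_def by blast
  thus ?thesis using eq cdist_clique[of u v s] assms(2) by simp
next
  assume "\<exists>x\<in>nbrs G v \<inter> X. close_val e (label v) (nbrs G v \<inter> X) = e x + 1"
  then obtain x where x: "x \<in> X" "(v, x) \<in> parcs G" "close_val e (label v) (nbrs G v \<inter> X) = e x + 1"
    by (auto simp: mem_nbrs)
  thus ?thesis using sound_X[OF assms(1) x(1)] cdist_step[OF E_sym[OF x(2)], of s] by simp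
qed

lemma sound_relax_at:
  assumes e: "sound s e" and v: "v \<in> pverts G" shows "sound s (relax_at v e)"
  unfolding sound_def
proof
  fix z assume z: "z \<in> X \<union> R"
  obtain u where u: "u \<in> pverts G" "label u = z" "cdist s u \<le> e z" using e z unfolding sound_def by blast
  let ?N = "nbrs G v \<inter> X"
  consider (nbr) "z \<in> ?N" | (self) "z \<notin> ?N" "z = label v" | (other) "z \<notin> ?N" "z \<noteq> label v" by blast
  thus "\<exists>v'\<in>pverts G. label v' = z \<and> cdist s v' \<le> relax_at v e z"
  proof cases
    case nbr
    hence "cdist s z \<le> cdist s v + 1" by (intro cdist_step) (simp add: mem_nbrs)
    hence "cdist s z \<le> close_val e (label v) ?N + 1" using close_val_sound[OF e v] by simp
    moreover have "cdist s z \<le> e z" using sound_X[OF e] nbr by simp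
    ultimately have "cdist s z \<le> relax_at v e z" using nbr by (simp add: relax_at_def relax_def)
    thus ?thesis using nbr X_V by (intro bexI[of _ z]) auto
  next
    \<comment> \<open>If the clique value drops through a neighbour of \<open>v\<close>, then
      \<open>v\<close> replaces the old vertex as the witness.\<close>
    case self
    hence "relax_at v e z = e z \<or> (\<exists>x\<in>?N. relax_at v e z = e x + 1)"
      using relax_self_cases[OF finite_nbrs_X, of "label v" v e] by (simp add: relax_at_def)
    thus ?thesis
    proof
      assume "\<exists>x\<in>?N. relax_at v e z = e x + 1"
      then obtain x where x: "x \<in> X" "(v, x) \<in> parcs G" "relax_at v e z = e x + 1" by (auto simp: mem_nbrs)
      hence "cdist s v \<le> relax_at v e z"
        using sound_X[OF e x(1)] cdist_step[OF E_sym[OF x(2)], of s] by simp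
      thus ?thesis using v self by blast
    qed (use u in auto)
  next
    case other
    thus ?thesis using u by (auto simp: relax_at_def relax_def)
  qed
qed

lemma relax_at_mono: "e \<le> e' \<Longrightarrow> relax_at v e \<le> relax_at v e'"
  unfolding relax_at_def by (intro relax_mono finite_nbrs_X)

lemma relax_at_le: "relax_at v e \<le> e"
  unfolding relax_at_def by (intro relax_le finite_nbrs_X)

lemma complete_mono: "complete s t e \<Longrightarrow> e' \<le> e \<Longrightarrow> complete s t e'"
  unfolding complete_def le_fun_def using le_trans by blast

lemma bounded_mono: "bounded s e \<Longrightarrow> e' \<le> e \<Longrightarrow> bounded s e'"
  unfolding bounded_def le_fun_def using le_trans by blast

text \<open>
  The delicate case is a vertex \<open>v \<in> X\<close> reached from \<open>u \<notin> X\<close>: the estimate for the clique of \<open>u\<close> may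
  belong to another vertex of the clique. It is the vertex before \<open>u\<close> that certifies the distance
  of \<open>u\<close>, or, if \<open>u\<close> is the source, the initial estimate.
\<close>

lemma complete_Suc:
  assumes e: "complete s t e" "bounded s e"
    and e': "e' \<le> e" "\<And>v. v \<in> pverts G \<Longrightarrow> e' \<le> relax_at v e"
  shows "complete s (Suc t) e'"
  unfolding complete_def
proof (intro ballI impI)
  fix v assume v: "v \<in> pverts G" "cdist s v \<le> Suc t"
  have old: "e' (label w) \<le> e (label w)" for w using e'(1) by (simp add: le_fun_def)
  show "e' (label v) \<le> cdist s v"
  proof (cases "cdist s v \<le> t \<or> cdist s v = cap")
    case True
    thus ?thesis using e v(1) old[of v] unfolding complete_def bounded_def by (metis le_trans)
  next
    case False
    hence d: "cdist s v = Suc t" "Suc t < cap" using v(2) cdist_le_cap[of s v] by auto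
    obtain u where u: "(u, v) \<in> parcs G" "cdist s u = t" using cdist_pred[OF d] by blast
    have uV: "u \<in> pverts G" using u(1) E_in_V by blast
    have eu: "e (label u) \<le> t" using e(1) uV u(2) unfolding complete_def by auto
    \<comment> \<open>From \<open>X\<close> the value is pulled when \<open>v\<close> is committed;
      within a clique the shared label already has a small enough value; out of a clique it is
      pushed when \<open>u\<close> is committed.\<close>
    consider (uX) "u \<in> X" | (clique) "u \<notin> X" "v \<notin> X" | (leave) "u \<notin> X" "v \<in> X" by blast
    thus ?thesis
    proof cases
      case uX
      have "e' (label v) \<le> relax_at v e (label v)" using e'(2)[OF v(1)] by (simp add: le_fun_def)
      also have "\<dots> \<le> e u + 1" unfolding relax_at_def
        using uX E_sym[OF u(1)] label_not_nbr[OF v(1)] finite_nbrs_X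
        by (intro relax_self_le) (auto simp: mem_nbrs)
      finally show ?thesis using eu uX d by simp
    next
      case clique
      hence "label v = label u" using label_eq_iff[OF uV v(1)] u(1) by simp
      thus ?thesis using old[of v] eu d by simp
    next
      case leave
      have "close_val e (label u) (nbrs G u \<inter> X) \<le> t \<or> e v \<le> 1 \<and> t = 0"
      proof (cases t)
        case 0
        hence "u = s" using u(2) cdist_zero by blast
        thus ?thesis using e(2) leave u(1) 0 unfolding bounded_def by (auto simp: mem_nbrs)
      next
        case (Suc t')
        then obtain w where w: "(w, u) \<in> parcs G" "cdist s w = t'"
          using cdist_pred[of s u t'] u(2) d by auto
        have wV: "w \<in> pverts G" using w(1) E_in_V by blast
        have ew: "e (label w) \<le> t'" using e(1) wV w(2) Suc unfolding complete_def by auto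
        show ?thesis
        proof (cases "w \<in> X")
          case True
          hence "close_val e (label u) (nbrs G u \<inter> X) \<le> e w + 1"
            using E_sym[OF w(1)] finite_nbrs_X by (intro close_val_le(2)) (auto simp: mem_nbrs)
          thus ?thesis using ew True Suc by simp
        next
          case False
          hence "label w = label u" using label_eq_iff[OF wV uV] w(1) leave by simp
          thus ?thesis using close_val_le(1)[OF finite_nbrs_X, of e "label u" u] ew Suc by simp
        qed
      qed
      moreover have "relax_at u e v \<le> close_val e (label u) (nbrs G u \<inter> X) + 1"
        using u(1) leave by (simp add: relax_at_def relax_def mem_nbrs)
      moreover have "e' v \<le> relax_at u e v" "e' v \<le> e v" using e' uV by (simp_all add: le_fun_def)
      ultimately show ?thesis using leave d by auto
    qed
  qed
qed

text \<open>The minimum is needed because \<open>close_val\<close> exceeds \<open>cap\<close> by 1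
  when all estimates involved equal \<open>cap\<close>.\<close>

definition read_off :: "(nat \<Rightarrow> nat) \<Rightarrow> nat \<Rightarrow> nat" where
  "read_off e v = min cap (if v \<in> X then e v else close_val e (label v) (nbrs G v \<inter> X))"

text \<open>The value read off at the source itself may be \<open>1\<close>, hence the maximum.\<close>

lemma read_off:
  assumes "sound s e" "complete s (cap - 1) e" "bounded s e" "v \<in> pverts G"
  shows "cdist s v \<le> read_off e v" "read_off e v \<le> max 1 (cdist s v)"
proof -
  show "cdist s v \<le> read_off e v"
    using sound_X[OF assms(1)] close_val_sound[OF assms(1,4)] cdist_le_cap by (simp add: read_off_def)
  have e: "e (label w) \<le> cdist s w" if "w \<in> pverts G" for w
  proof (cases "cdist s w = cap")
    case True
    thus ?thesis using assms(3) by (simp add: bounded_def)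
  next
    case False
    hence "cdist s w \<le> cap - 1" using cdist_le_cap[of s w] by simp
    thus ?thesis using assms(2) that by (simp add: complete_def)
  qed
  show "read_off e v \<le> max 1 (cdist s v)"
  proof (cases "v \<in> X \<or> cdist s v = cap")
    case True
    thus ?thesis using e[OF assms(4)] by (auto simp: read_off_def)
  next
    case False
    have c: "read_off e v \<le> close_val e (label v) (nbrs G v \<inter> X)" using False by (simp add: read_off_def)
    show ?thesis
    proof (cases "cdist s v")
      case 0
      thus ?thesis using c close_val_le(1)[OF finite_nbrs_X, of e "label v" v] e[OF assms(4)] by simp
    next
      case (Suc t)
      moreover have "Suc t < cap" using Suc False cdist_le_cap[of s v] by simp
      ultimately obtain u where u: "(u, v) \<in> parcs G" "cdist s u = t" using cdist_pred by blast
      have uV: "u \<in> pverts G" using u(1) E_in_V by blast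
      have "close_val e (label v) (nbrs G v \<inter> X) \<le> e (label u) + 1"
      proof (cases "u \<in> X")
        case True
        thus ?thesis using E_sym[OF u(1)] finite_nbrs_X
          by (intro close_val_le(2)[THEN order_trans, of _ u]) (auto simp: mem_nbrs)
      next
        case F: False
        hence "label u = label v" using label_eq_iff[OF uV assms(4)] u(1) False by simp
        thus ?thesis using close_val_le(1)[OF finite_nbrs_X, of e "label v" v] by simp
      qed
      thus ?thesis using c e[OF uV] u(2) Suc by simp
    qed
  qed
qed

definition matches :: "nat \<Rightarrow> nat \<times> nat list \<Rightarrow> bool" where
  "matches v src \<longleftrightarrow> label v = fst src \<and> (v \<in> X \<or> set (snd src) = nbrs G v \<inter> X)"

lemma finite_R: "finite R"
  using R_X pair_finite_verts by (meson finite_subset subsetI)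

lemma sources_cover:
  assumes "v \<in> pverts G" obtains i where "i < length (sources X R)" "matches v (sources X R ! i)"
proof -
  have "\<exists>src\<in>set (sources X R). matches v src"
  proof (cases "v \<in> X")
    case True
    thus ?thesis using finite_X by (intro bexI[of _ "(v, [])"]) (auto simp: matches_def sources_def)
  next
    case False
    have "nbrs G v \<inter> X \<in> set ` set (subseqs (sorted_list_of_set X))"
      using finite_X by (simp add: subseqs_powset)
    then obtain S where "S \<in> set (subseqs (sorted_list_of_set X))" "set S = nbrs G v \<inter> X" by auto
    thus ?thesis using finite_R label_R[OF assms False]
      by (intro bexI[of _ "(label v, S)"]) (auto simp: matches_def sources_def)
  qed
  thus ?thesis using that by (metis in_set_conv_nth)
qed

text \<open>Holds for every vertex \<open>s\<close> that matches the source, so one search serves a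
  whole class at once.\<close>

lemma start_props:
  assumes src: "src \<in> set (sources X R)" and s: "s \<in> pverts G" "matches s src"
  shows "sound s (start X R src)" "complete s 0 (start X R src)" "bounded s (start X R src)"
proof -
  have S: "set (snd src) \<subseteq> nbrs G s \<inter> X"
  proof (cases "s \<in> X")
    case True
    hence "fst src \<notin> R" using s label_in_X_iff R_X by (auto simp: matches_def)
    thus ?thesis using src finite_R by (auto simp: sources_def)
  qed (use s in \<open>simp add: matches_def\<close>)
  have fst: "label s = fst src" using s by (simp add: matches_def)
  show "sound s (start X R src)" unfolding sound_def
  proof
    fix z assume z: "z \<in> X \<union> R"
    hence zV: "z \<in> pverts G" using X_V R_X by blast
    show "\<exists>v\<in>pverts G. label v = z \<and> cdist s v \<le> start X R src z"
    proof (cases "z = fst src")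
      case True
      thus ?thesis using s(1) fst by (intro bexI[of _ s]) (auto simp: cdist_self)
    next
      case False
      have "cdist s z \<le> start X R src z"
      proof (cases "z \<in> set (snd src)")
        case True
        hence "(s, z) \<in> parcs G" using S by (auto simp: mem_nbrs)
        thus ?thesis using cdist_step[of s z s] False z True by (simp add: start_def cdist_self)
      next
        case F: False
        thus ?thesis using cdist_le_cap[of s z] False z by (simp add: start_def cap_def)
      qed
      thus ?thesis using zV label_id[OF z] by blast
    qed
  qed
  show "complete s 0 (start X R src)"
    using cdist_zero[of s] fst by (auto simp: complete_def start_def)
  show "bounded s (start X R src)"
    using s by (auto simp: bounded_def start_def cap_def matches_def)
qed

end

section \<open>The many-pass sketch\<close>

text \<open>Phase 0 collects representatives, phase i+1 runs the search from source number i.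
  \<open>seen\<close> tells whether the source occurs in the graph, \<open>far\<close> is the
  largest value read off in the current pass, and \<open>best\<close> the maximum over finished
  searches.\<close>

record multi_state =
  modulator :: "nat set"
  representatives :: "nat set"
  phase :: nat
  round :: nat
  est :: "nat \<Rightarrow> nat"
  seen :: bool
  far :: nat
  best :: nat

definition multi_init :: "nat set \<Rightarrow> multi_state" where
  "multi_init X = \<lparr>modulator = X, representatives = {}, phase = 0, round = 0, est = (\<lambda>_. 0), seen = False, far = 0, best = 0\<rparr>"

abbreviation source_list :: "multi_state \<Rightarrow> (nat \<times> nat list) list" where
  "source_list s \<equiv> sources (modulator s) (representatives s)"

definition multi_commit :: "multi_state \<Rightarrow> nat \<Rightarrow> nat set \<Rightarrow> multi_state" where
  "multi_commit s v N = (let X = modulator s; R = representatives s; z = lab X R v N; M = N \<inter> X; src = source_list s ! (phase s - 1) in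
     if phase s = 0 then s\<lparr>representatives := add_rep X R v N\<rparr>
     else s\<lparr>est := relax (est s) z M,
       seen := seen s \<or> z = fst src \<and> (v \<in> X \<or> set (snd src) = M),
       far := max (far s) (min (3 * card X + 2) (if v \<in> X then est s v else close_val (est s) z M))\<rparr>)"

definition begin_source :: "nat \<Rightarrow> nat \<Rightarrow> multi_state \<Rightarrow> multi_state" where
  "begin_source i b s = s\<lparr>phase := Suc i, round := 0,
     est := (if i < length (source_list s) then start (modulator s) (representatives s) (source_list s ! i) else (\<lambda>_. 0)),
     seen := False, far := 0, best := b\<rparr>"

text \<open>A search takes exactly \<open>cap\<close> passes: rounds 0 to 3k relax, and round 3k+1
  supplies the \<open>far\<close> that counts. If no vertex matched the source, the estimates mean
  nothing and \<open>far\<close> is dropped. A phase beyond the list of sources marks the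
  end.\<close>

definition multi_end :: "multi_state \<Rightarrow> multi_state" where
  "multi_end s = (if phase s = 0 then begin_source 0 0 s
     else if phase s > length (source_list s) then s
     else if round s < 3 * card (modulator s) + 1 then s\<lparr>round := Suc (round s), far := 0\<rparr>
     else begin_source (phase s) (if seen s then max (best s) (far s) else best s) s)"

text \<open>For empty \<open>X\<close> the answer must follow the first pass, the only one allowed
  when k = 0; it depends on whether there is one clique or several.\<close>

definition multi_out :: "multi_state \<Rightarrow> ereal option" where
  "multi_out s = (if phase s = 0 then None
     else if modulator s = {} then Some (of_cap 2 (if card (representatives s) = 1 then 1 else 2))
     else if phase s > length (source_list s) then Some (of_cap (3 * card (modulator s) + 2) (best s))
     else None)"

definition multi_valid :: "multi_state \<Rightarrow> bool" where
  "multi_valid s \<longleftrightarrow> finite (modulator s) \<and> finite (representatives s) \<and> (\<forall>z. z \<notin> modulator s \<union> representatives s \<longrightarrow> est s z = 0)"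

definition multi_flat :: "multi_state \<Rightarrow> nat list list" where
  "multi_flat s = [sorted_list_of_set (modulator s), sorted_list_of_set (representatives s),
     [phase s, round s, of_bool (seen s), far s, best s], map (est s) (sorted_list_of_set (modulator s \<union> representatives s))]"

lemma inj_multi_flat: "inj_on multi_flat (Collect multi_valid)"
proof (rule inj_onI)
  fix s s' assume "s \<in> Collect multi_valid" "s' \<in> Collect multi_valid" and eq: "multi_flat s = multi_flat s'"
  hence v: "multi_valid s" "multi_valid s'" by auto
  have fin: "finite (modulator s)" "finite (representatives s)" "finite (modulator s')" "finite (representatives s')"
    using v by (auto simp: multi_valid_def)
  have "sorted_list_of_set (modulator s) = sorted_list_of_set (modulator s')"
    "sorted_list_of_set (representatives s) = sorted_list_of_set (representatives s')"
    using eq by (simp_all add: multi_flat_def)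
  hence X: "modulator s = modulator s'" and R: "representatives s = representatives s'"
    using fin by (auto dest: sorted_list_of_set_inject)
  have on: "est s z = est s' z" if "z \<in> modulator s \<union> representatives s" for z
    using eq that fin by (auto simp: multi_flat_def X R)
  have "est s = est s'"
  proof
    fix z show "est s z = est s' z" using on[of z] v X R by (cases "z \<in> modulator s \<union> representatives s") (auto simp: multi_valid_def)
  qed
  moreover have "phase s = phase s'" "round s = round s'" "seen s = seen s'" "far s = far s'" "best s = best s'"
    using eq by (simp_all add: multi_flat_def of_bool_eq_iff)
  ultimately show "s = s'" using X R by simp
qed

interpretation multi: sketch multi_init "\<lambda>s. modulator s \<union> representatives s" multi_commit multi_end multi_out 0 multi_flat multi_valid
proof
  show "inj_on multi_flat (Collect multi_valid)" by (rule inj_multi_flat)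
next
  fix s v N assume s: "multi_valid s"
  show "multi_valid (multi_commit s v N)"
  proof (cases "phase s = 0")
    case True
    thus ?thesis using s by (auto simp: multi_valid_def multi_commit_def add_rep_def Let_def)
  next
    case False
    \<comment> \<open>Since \<open>relax\<close> never increases a value, the default 0 off the
      watched set survives.\<close>
    have "relax (est s) z (N \<inter> modulator s) y \<le> est s y" for z y
      using relax_le[of "N \<inter> modulator s" "est s" z] s by (simp add: multi_valid_def le_fun_def)
    moreover have "\<forall>y. y \<notin> modulator s \<union> representatives s \<longrightarrow> est s y = 0" using s by (simp add: multi_valid_def)
    ultimately have "\<forall>y. y \<notin> modulator s \<union> representatives s \<longrightarrow> relax (est s) z (N \<inter> modulator s) y = 0" for z
      by (metis le_zero_eq)
    thus ?thesis using s False by (simp add: multi_valid_def multi_commit_def Let_def)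
  qed
qed (auto simp: multi_valid_def multi_end_def multi_init_def begin_source_def start_def)

context clique_modulator_graph
begin

lemma multi_scan_reps:
  assumes "modulator s = X" "phase s = 0" "rep_set (representatives s)" "set vs \<subseteq> pverts G"
  shows "\<exists>R. multi.scan G s vs = s\<lparr>representatives := R\<rparr> \<and> rep_set R \<and> representatives s \<subseteq> R \<and> (\<forall>v\<in>set vs - X. \<exists>r. is_lab R v r)"
  using assms
proof (induction vs arbitrary: s)
  case Nil
  thus ?case by (intro exI[of _ "representatives s"]) simp
next
  case (Cons v vs)
  define R' where "R' = add_rep X (representatives s) v (nbrs G v \<inter> (X \<union> representatives s))"
  have R': "rep_set R'" using rep_set_add_rep Cons.prems by (simp add: R'_def)
  have step: "multi_commit s v (nbrs G v \<inter> (modulator s \<union> representatives s)) = s\<lparr>representatives := R'\<rparr>"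
    using Cons.prems by (simp add: multi_commit_def R'_def)
  obtain R where R: "multi.scan G (s\<lparr>representatives := R'\<rparr>) vs = s\<lparr>representatives := R'\<rparr>\<lparr>representatives := R\<rparr>" "rep_set R" "R' \<subseteq> R"
    "\<forall>v\<in>set vs - X. \<exists>r. is_lab R v r"
    using Cons.IH[of "s\<lparr>representatives := R'\<rparr>"] Cons.prems R' by auto
  have "representatives s \<subseteq> R'" by (auto simp: R'_def add_rep_def)
  moreover have "\<exists>r. is_lab R v r" if "v \<notin> X"
    using is_lab_add_rep[OF that, of "representatives s"] R(3) unfolding R'_def[symmetric] by (auto simp: is_lab_def)
  ultimately show ?case using R step by (intro exI[of _ R]) auto
qed

end

context represented
begin

abbreviation srcs :: "(nat \<times> nat list) list" where
  "srcs \<equiv> sources X R"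

definition at_phase :: "nat \<Rightarrow> multi_state \<Rightarrow> bool" where
  "at_phase i s \<longleftrightarrow> modulator s = X \<and> representatives s = R \<and> phase s = Suc i"

lemma multi_commit_eq:
  assumes "at_phase i s"
  shows "multi_commit s v (nbrs G v \<inter> (modulator s \<union> representatives s)) = s\<lparr>est := relax_at v (est s),
    seen := seen s \<or> matches v (srcs ! i), far := max (far s) (read_off (est s) v)\<rparr>"
proof -
  have "nbrs G v \<inter> (X \<union> R) \<inter> X = nbrs G v \<inter> X" by blast
  thus ?thesis using assms
    by (simp add: multi_commit_def at_phase_def Let_def relax_at_def matches_def read_off_def label_def cap_def)
qed

lemma multi_scan:
  assumes "at_phase i s"
  shows "at_phase i (multi.scan G s vs) \<and> round (multi.scan G s vs) = round s \<and> best (multi.scan G s vs) = best s \<and>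
    est (multi.scan G s vs) = foldl (\<lambda>e v. relax_at v e) (est s) vs \<and>
    (seen (multi.scan G s vs) \<longleftrightarrow> seen s \<or> (\<exists>v\<in>set vs. matches v (srcs ! i)))"
  using assms
proof (induction vs arbitrary: s)
  case (Cons v vs)
  have "at_phase i (multi_commit s v (nbrs G v \<inter> (modulator s \<union> representatives s)))"
    using Cons.prems unfolding multi_commit_eq[OF Cons.prems] by (simp add: at_phase_def)
  from Cons.IH[OF this] show ?case by (auto simp: multi_commit_eq[OF Cons.prems])
qed simp

text \<open>Estimates may still change during the read-off pass, but all three properties persist,
  so each vertex is read off correctly wherever it stands in the stream.\<close>

lemma multi_scan_far:
  assumes "at_phase i s" "sound a (est s)" "complete a (cap - 1) (est s)" "bounded a (est s)" "set vs \<subseteq> pverts G"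
  shows "far s \<le> far (multi.scan G s vs) \<and> (\<forall>v\<in>set vs. cdist a v \<le> far (multi.scan G s vs)) \<and>
    (far (multi.scan G s vs) = far s \<or> (\<exists>v\<in>set vs. far (multi.scan G s vs) \<le> max 1 (cdist a v)))"
  using assms
proof (induction vs arbitrary: s)
  case (Cons v vs)
  define s' where "s' = multi_commit s v (nbrs G v \<inter> (modulator s \<union> representatives s))"
  have s': "s' = s\<lparr>est := relax_at v (est s),
      seen := seen s \<or> matches v (srcs ! i), far := max (far s) (read_off (est s) v)\<rparr>"
    unfolding s'_def by (rule multi_commit_eq) fact
  have v: "v \<in> pverts G" using Cons.prems by simp
  have "at_phase i s'" using Cons.prems by (simp add: s' at_phase_def)
  moreover have "sound a (est s')" using sound_relax_at Cons.prems v by (simp add: s')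
  moreover have "complete a (cap - 1) (est s')" "bounded a (est s')"
    using complete_mono bounded_mono relax_at_le Cons.prems by (auto simp: s')
  ultimately have IH: "far s' \<le> far (multi.scan G s' vs)" "\<forall>v\<in>set vs. cdist a v \<le> far (multi.scan G s' vs)"
    "far (multi.scan G s' vs) = far s' \<or> (\<exists>v\<in>set vs. far (multi.scan G s' vs) \<le> max 1 (cdist a v))"
    using Cons.IH[of s'] Cons.prems by auto
  have far: "far s' = max (far s) (read_off (est s) v)" by (simp add: s')
  have r: "cdist a v \<le> read_off (est s) v" "read_off (est s) v \<le> max 1 (cdist a v)"
    using read_off[OF Cons.prems(2,3,4) v] by auto
  have scan: "multi.scan G s (v # vs) = multi.scan G s' vs" by (simp add: s'_def)
  show ?case unfolding scan using IH far r by (auto simp: max_def split: if_splits)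
qed simp

definition ready :: "nat \<Rightarrow> multi_state \<Rightarrow> bool" where
  "ready i s \<longleftrightarrow> at_phase i s \<and> round s = 0 \<and> \<not> seen s \<and> far s = 0 \<and>
     (i < length srcs \<longrightarrow> est s = start X R (srcs ! i))"

definition so_far :: "nat \<Rightarrow> nat \<Rightarrow> bool" where
  "so_far i b \<longleftrightarrow> (\<forall>j<i. \<forall>a\<in>pverts G. matches a (srcs ! j) \<longrightarrow> (\<forall>v\<in>pverts G. cdist a v \<le> b)) \<and>
     (\<exists>a\<in>pverts G. \<exists>v\<in>pverts G. b \<le> cdist a v)"

context
  fixes vs :: "nat list"
  assumes vs: "set vs = pverts G"
begin

abbreviation pass :: "multi_state \<Rightarrow> multi_state" where
  "pass s \<equiv> multi_end (multi.scan G s vs)"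

lemma est_scan:
  assumes "sound a e" "complete a t e" "bounded a e"
  shows "sound a (foldl (\<lambda>e v. relax_at v e) e vs)" "complete a (Suc t) (foldl (\<lambda>e v. relax_at v e) e vs)"
    "bounded a (foldl (\<lambda>e v. relax_at v e) e vs)"
proof -
  have le: "foldl (\<lambda>e v. relax_at v e) e vs \<le> e"
    by (rule foldl_descending(1)) (use relax_at_mono relax_at_le in auto)
  have le': "foldl (\<lambda>e v. relax_at v e) e vs \<le> relax_at v e" if "v \<in> pverts G" for v
    by (rule foldl_descending(2)) (use relax_at_mono relax_at_le that vs in auto)
  show "complete a (Suc t) (foldl (\<lambda>e v. relax_at v e) e vs)"
    using complete_Suc[OF assms(2,3) le le'] by blast
  show "bounded a (foldl (\<lambda>e v. relax_at v e) e vs)" using bounded_mono[OF assms(3) le] .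
  have "set us \<subseteq> pverts G \<Longrightarrow> sound a (foldl (\<lambda>e v. relax_at v e) e us)" for us
    using assms(1) by (induction us rule: rev_induct) (auto intro: sound_relax_at)
  thus "sound a (foldl (\<lambda>e v. relax_at v e) e vs)" using vs by simp
qed

lemma pass_round:
  assumes "at_phase i s" "i < length srcs" "round s < cap - 1"
  shows "pass s = (multi.scan G s vs)\<lparr>round := Suc (round s), far := 0\<rparr>"
  using multi_scan[OF assms(1), of vs] assms by (simp add: multi_end_def at_phase_def cap_def)

lemma rounds:
  assumes s: "ready i s" and i: "i < length srcs" and t: "t \<le> cap - 1"
  shows "at_phase i ((pass ^^ t) s) \<and> round ((pass ^^ t) s) = t \<and> best ((pass ^^ t) s) = best s \<and> far ((pass ^^ t) s) = 0 \<and>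
    (seen ((pass ^^ t) s) \<longrightarrow> (\<exists>v\<in>pverts G. matches v (srcs ! i))) \<and>
    (\<forall>a\<in>pverts G. matches a (srcs ! i) \<longrightarrow> sound a (est ((pass ^^ t) s)) \<and>
       complete a t (est ((pass ^^ t) s)) \<and> bounded a (est ((pass ^^ t) s)))"
  using t
proof (induction t)
  case 0
  thus ?case using s i start_props[of "srcs ! i"] by (simp add: ready_def)
next
  case (Suc t)
  define s' where "s' = (pass ^^ t) s"
  have IH: "at_phase i s'" "round s' = t" "best s' = best s" "seen s' \<longrightarrow> (\<exists>v\<in>pverts G. matches v (srcs ! i))"
    "\<And>a. a \<in> pverts G \<Longrightarrow> matches a (srcs ! i) \<Longrightarrow> sound a (est s') \<and> complete a t (est s') \<and> bounded a (est s')"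
    using Suc unfolding s'_def by auto
  have eq: "(pass ^^ Suc t) s = (multi.scan G s' vs)\<lparr>round := Suc t, far := 0\<rparr>"
    using pass_round[OF IH(1) i] IH(2) Suc.prems by (simp add: s'_def)
  note sc = multi_scan[OF IH(1), of vs]
  have "at_phase i ((multi.scan G s' vs)\<lparr>round := Suc t, far := 0\<rparr>)"
    using sc by (simp add: at_phase_def)
  moreover have "sound a (est (multi.scan G s' vs)) \<and> complete a (Suc t) (est (multi.scan G s' vs)) \<and>
      bounded a (est (multi.scan G s' vs))" if "a \<in> pverts G" "matches a (srcs ! i)" for a
    using est_scan[of a "est s'" t] IH(5)[OF that] sc by simp
  ultimately show ?case unfolding eq using sc IH(3,4) vs by simp
qed

lemma block:
  assumes s: "ready i s" "so_far i (best s)" and i: "i < length srcs" and card: "2 \<le> card (pverts G)"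
  shows "ready (Suc i) ((pass ^^ cap) s) \<and> so_far (Suc i) (best ((pass ^^ cap) s))"
proof -
  define s' where "s' = (pass ^^ (cap - 1)) s"
  define u where "u = multi.scan G s' vs"
  note r = rounds[OF s(1) i order_refl, folded s'_def]
  have ph: "at_phase i s'" using r by blast
  have scan: "at_phase i u" "round u = cap - 1" "best u = best s"
    "seen u \<longleftrightarrow> (\<exists>v\<in>pverts G. matches v (srcs ! i))"
    using multi_scan[OF ph, of vs] r vs by (auto simp: u_def)
  have c: "Suc (cap - 1) = cap" by (simp add: cap_def)
  have "(pass ^^ Suc (cap - 1)) s = pass s'" by (simp add: s'_def)
  hence "(pass ^^ cap) s = pass s'" unfolding c .
  also have "\<dots> = begin_source (Suc i) (if seen u then max (best u) (far u) else best u) u"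
    using scan i unfolding u_def[symmetric] by (simp add: multi_end_def at_phase_def cap_def)
  finally have eq: "(pass ^^ cap) s = begin_source (Suc i) (if seen u then max (best u) (far u) else best u) u" .
  have "ready (Suc i) ((pass ^^ cap) s)"
    using scan(1) by (simp add: eq ready_def begin_source_def at_phase_def)
  moreover have "so_far (Suc i) (if seen u then max (best u) (far u) else best u)"
  proof (cases "seen u")
    case False
    thus ?thesis using s(2) scan unfolding so_far_def by (auto simp: less_Suc_eq)
  next
    case True
    have far: "\<forall>v\<in>pverts G. cdist a v \<le> far u" "far u = 0 \<or> (\<exists>v\<in>pverts G. far u \<le> max 1 (cdist a v))"
      if "a \<in> pverts G" "matches a (srcs ! i)" for a
      using multi_scan_far[OF ph, of a vs] r that vs by (auto simp: u_def)
    obtain a where a: "a \<in> pverts G" "matches a (srcs ! i)" using True scan by blast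
    obtain v0 where v0: "v0 \<in> pverts G" "v0 \<noteq> a"
    proof -
      have "pverts G \<noteq> {a}" using card by auto
      thus ?thesis using a that by blast
    qed
    hence 1: "1 \<le> cdist a v0" using cdist_zero[of a v0] by fastforce
    \<comment> \<open>A value read off exceeds the true distance only if it is 1; the second vertex
      \<open>v0\<close> shows that 1 is reached anyway.\<close>
    have "\<exists>v\<in>pverts G. far u \<le> cdist a v"
    proof (cases "far u \<le> 1")
      case True
      thus ?thesis using 1 v0(1) le_trans by blast
    next
      case False
      thus ?thesis using far(2)[OF a] by (auto simp: le_max_iff_disj)
    qed
    moreover have "\<exists>a\<in>pverts G. \<exists>v\<in>pverts G. best s \<le> cdist a v" using s(2) by (simp add: so_far_def)
    ultimately have "\<exists>a\<in>pverts G. \<exists>v\<in>pverts G. max (best s) (far u) \<le> cdist a v"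
      using a(1) by (cases "best s \<le> far u") (auto simp: max_def)
    moreover have "cdist b v \<le> max (best s) (far u)"
      if "j < Suc i" "b \<in> pverts G" "matches b (srcs ! j)" "v \<in> pverts G" for j b v
    proof (cases "j = i")
      case True
      hence "cdist b v \<le> far u" using far(1) that by blast
      thus ?thesis by simp
    next
      case False
      hence "j < i" using that(1) by simp
      hence "cdist b v \<le> best s" using s(2) that unfolding so_far_def by blast
      thus ?thesis by simp
    qed
    ultimately show ?thesis using True scan(3) unfolding so_far_def by simp
  qed
  ultimately show ?thesis by (simp add: eq begin_source_def)
qed

lemma blocks:
  assumes s: "ready 0 s" "so_far 0 (best s)" and card: "2 \<le> card (pverts G)" and i: "i \<le> length srcs"
  shows "ready i ((pass ^^ (i * cap)) s) \<and> so_far i (best ((pass ^^ (i * cap)) s))"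
  using i
proof (induction i)
  case (Suc i)
  have "(pass ^^ (Suc i * cap)) s = (pass ^^ cap) ((pass ^^ (i * cap)) s)"
    by (simp add: funpow_add)
  thus ?case using block[of i "(pass ^^ (i * cap)) s"] Suc card by simp
qed (use s in simp)

lemma multi_run:
  assumes s: "ready 0 s" "so_far 0 (best s)" and card: "2 \<le> card (pverts G)" and X: "X \<noteq> {}"
  shows "q < length srcs * cap \<Longrightarrow> multi_out ((pass ^^ q) s) = None"
    and "multi_out ((pass ^^ (length srcs * cap)) s) = Some (diameter G)"
proof -
  have c: "0 < cap" by (simp add: cap_def)
  {
    assume q: "q < length srcs * cap"
    \<comment> \<open>After q passes the search for source q div \<open>cap\<close> is in round q
      mod \<open>cap\<close>, hence not yet finished.\<close>
    define i where "i = q div cap"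
    define t where "t = q mod cap"
    have i: "i < length srcs" using q by (simp add: i_def less_mult_imp_div_less)
    have "q = t + i * cap" by (simp add: i_def t_def)
    hence "(pass ^^ q) s = (pass ^^ t) ((pass ^^ (i * cap)) s)" by (simp add: funpow_add)
    moreover have "t \<le> cap - 1" using c by (simp add: t_def less_Suc_eq_le[symmetric])
    ultimately have "at_phase i ((pass ^^ q) s)"
      using rounds[of i "(pass ^^ (i * cap)) s" t] blocks[OF s card, of i] i by simp
    thus "multi_out ((pass ^^ q) s) = None" using X i by (simp add: multi_out_def at_phase_def)
  }
  define u where "u = (pass ^^ (length srcs * cap)) s"
  have u: "ready (length srcs) u" "so_far (length srcs) (best u)"
    using blocks[OF s card order_refl] by (simp_all add: u_def)
  obtain a v where av: "a \<in> pverts G" "v \<in> pverts G" "best u \<le> cdist a v"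
    using u(2) by (auto simp: so_far_def)
  have "ecc_max = best u"
  proof (rule ecc_maxI)
    show "cdist b w \<le> best u" if "b \<in> pverts G" "w \<in> pverts G" for b w
      using sources_cover[OF that(1)] u(2) that unfolding so_far_def by blast
  qed fact+
  moreover have "diameter G = of_cap cap ecc_max" using av by (intro diameter_eq) auto
  ultimately show "multi_out ((pass ^^ (length srcs * cap)) s) = Some (diameter G)"
    using u(1) X unfolding u_def[symmetric] by (simp add: multi_out_def ready_def at_phase_def cap_def)
qed

end

text \<open>Without a modulator the cliques are the components, and \<open>cap\<close> is 2, so that
  2 encodes infinity.\<close>

lemma diameter_no_modulator:
  assumes "X = {}" "2 \<le> card (pverts G)"
  shows "diameter G = of_cap 2 (if card R = 1 then 1 else 2)"
proof -
  have cap: "cap = 2" unfolding cap_def using assms by simp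
  have ne: "pverts G \<noteq> {}" using assms by auto
  obtain v where v: "v \<in> pverts G" using ne by blast
  have "ecc_max = (if card R = 1 then 1 else 2)"
  proof (cases "card R = 1")
    case True
    then obtain r where R: "R = {r}" by (auto simp: card_1_singleton_iff)
    have "cdist a b \<le> 1" if "a \<in> pverts G" "b \<in> pverts G" for a b
      using cdist_same_label[OF that] label_R[OF that(1)] label_R[OF that(2)] R assms(1) by simp
    hence "ecc_max \<le> 1" using ecc_max_attained[OF ne] by metis
    thus ?thesis using True ecc_max_ge_1 assms by simp
  next
    case False
    have "label v \<in> R" using label_R v assms by simp
    then obtain r r' where r: "r \<in> R" "r' \<in> R" "r \<noteq> r'"
      using False by (metis is_singletonI' is_singleton_altdef empty_iff)
    have "label w = label r" if "(r, w) \<in> (parcs G)\<^sup>*" for w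
      using that
    proof (induction rule: rtrancl_induct)
      case (step y z)
      thus ?case using label_eq_iff[of y z] E_in_V assms(1) by simp
    qed simp
    hence "(r, r') \<notin> (parcs G)\<^sup>*" using r label_rep by metis
    hence "cdist r r' = 2" using cap by (simp add: cdist_def)
    hence "ecc_max = 2" using r R_X cdist_le_cap cap by (intro ecc_maxI[of _ r r']) auto
    thus ?thesis using False by simp
  qed
  thus ?thesis using diameter_eq[OF ne] cap by simp
qed

end

section \<open>Memory and passes of the many-pass algorithm\<close>

definition multi_inv :: "nat pair_pre_digraph \<Rightarrow> nat set \<Rightarrow> multi_state \<Rightarrow> bool" where
  "multi_inv G X s \<longleftrightarrow> modulator s = X \<and> clique_modulator_graph.rep_set G X (representatives s) \<and>
     phase s \<le> Suc (length (source_list s)) \<and> (\<forall>z. est s z \<le> 3 * card X + 2) \<and>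
     round s \<le> 3 * card X + 2 \<and> far s \<le> 3 * card X + 2 \<and> best s \<le> 3 * card X + 2"

lemma (in clique_modulator_graph)
  shows multi_inv_init: "multi_inv G X (multi_init X)"
    and multi_inv_commit: "multi_inv G X s \<Longrightarrow> v \<in> pverts G \<Longrightarrow>
      multi_inv G X (multi_commit s v (nbrs G v \<inter> (modulator s \<union> representatives s)))"
    and multi_inv_end: "multi_inv G X s \<Longrightarrow> multi_inv G X (multi_end s)"
proof -
  show "multi_inv G X (multi_init X)"
    by (simp add: multi_inv_def multi_init_def rep_set_empty)
  show "multi_inv G X (multi_commit s v (nbrs G v \<inter> (modulator s \<union> representatives s)))"
    if "multi_inv G X s" "v \<in> pverts G"
  proof (cases "phase s = 0")
    case True
    thus ?thesis using that rep_set_add_rep by (simp add: multi_inv_def multi_commit_def)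
  next
    case False
    have "relax (est s) z (N \<inter> X) y \<le> 3 * card X + 2" for z N y
    proof (rule le_trans)
      show "relax (est s) z (N \<inter> X) y \<le> est s y"
        using relax_le[of "N \<inter> X" "est s" z] finite_X by (simp add: le_fun_def)
      show "est s y \<le> 3 * card X + 2" using that(1) unfolding multi_inv_def by blast
    qed
    moreover have "modulator s = X" using that(1) unfolding multi_inv_def by blast
    ultimately show ?thesis using that False by (simp add: multi_inv_def multi_commit_def Let_def)
  qed
  show "multi_inv G X (multi_end s)" if "multi_inv G X s"
    using that by (auto simp: multi_inv_def multi_end_def begin_source_def start_def)
qed

lemma multi_bits:
  assumes inst: "instance_of n k l G X" and n: "n \<le> 2 ^ B" "1 \<le> B" and s: "multi_inv G X s"
    and buf: "buf = None \<or> (\<exists>v N. buf = Some (v, N) \<and> v \<in> pverts G \<and> N \<subseteq> X \<union> representatives s)"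
  shows "length (multi.encode (s, buf)) \<le> 100 * ((k + l) * B)"
proof -
  interpret clique_modulator_graph G X using inst by (rule instance_of_modulator)
  have V: "pverts G = {..<n}" "card X = k" "1 \<le> l" using inst unfolding instance_of_def by blast+
  have X: "modulator s = X" and R: "rep_set (representatives s)" using s by (auto simp: multi_inv_def)
  have Rl: "card (representatives s) \<le> l"
    using R inst by (intro instance_of_independent[OF inst]) (auto simp: rep_set_def)
  have RV: "representatives s \<subseteq> pverts G" using R by (auto simp: rep_set_def)
  have fin: "finite X" "finite (representatives s)" using finite_X RV finite_subset pair_finite_verts by blast+
  have small: "m < 2 ^ B" if "m \<in> pverts G" for m using that V n by auto
  have kl: "k + l \<le> 2 ^ B" using instance_of_n[OF inst] n by simp
  have two: "2 \<le> (2::nat) ^ B" using n(2) power_increasing[of 1 B "2::nat"] by simp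
  \<comment> \<open>Three extra bits suffice as k and 2 are both at most 2^B.\<close>
  have K: "m < 2 ^ (B + 3)" if "m \<le> 3 * k + 2" for m
    using that kl two by (simp add: power_add)
  have Un: "card (X \<union> representatives s) \<le> k + l" using card_Un_le[of X "representatives s"] Rl V by simp
  have c1: "cost (sorted_list_of_set X) \<le> k * (2 * B + 2) + 2"
    using small X_V fin V by (intro cost_le) auto
  have c2: "cost (sorted_list_of_set (representatives s)) \<le> l * (2 * B + 2) + 2"
    using small RV fin Rl by (intro cost_le) auto
  \<comment> \<open>The index of a source can be of order 2^k l, but its binary length k + O(log n)
    stays within the budget.\<close>
  have "phase s < 2 ^ (k + B + 3)"
  proof -
    have "phase s \<le> Suc (k + card (representatives s) * 2 ^ k)"
      using s length_sources[OF fin(1), of "representatives s"] V X by (simp add: multi_inv_def)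
    also have "\<dots> \<le> Suc (k + l * 2 ^ k)" using Rl by simp
    also have "\<dots> \<le> 2 ^ k + (2 ^ k + l * 2 ^ k)"
      using less_exp[of k] by linarith
    also have "\<dots> = 2 ^ k * (l + 2)" by (simp add: algebra_simps)
    also have "\<dots> < 2 ^ k * 2 ^ (B + 3)"
    proof (rule mult_strict_left_mono)
      have "(2::nat) ^ (B + 3) = 8 * 2 ^ B" by (simp add: power_add)
      thus "l + 2 < 2 ^ (B + 3)" using kl two by linarith
    qed simp
    finally show ?thesis by (simp add: power_add mult.assoc)
  qed
  moreover have "m < 2 ^ (k + B + 3)" if "m \<le> 3 * k + 2" for m
  proof -
    have "(2::nat) ^ (B + 3) \<le> 2 ^ (k + B + 3)" by (intro power_increasing) auto
    thus ?thesis using K[OF that] by linarith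
  qed
  moreover have "round s \<le> 3 * k + 2" "far s \<le> 3 * k + 2" "best s \<le> 3 * k + 2"
    "of_bool (seen s) \<le> 3 * k + 2" using s V by (auto simp: multi_inv_def)
  ultimately have c3: "cost [phase s, round s, of_bool (seen s), far s, best s] \<le> 5 * (2 * (k + B + 3) + 2) + 2"
    by (intro cost_le) auto
  have c4: "cost (map (est s) (sorted_list_of_set (X \<union> representatives s))) \<le> (k + l) * (2 * (B + 3) + 2) + 2"
    using s V Un K fin by (intro cost_le) (auto simp: multi_inv_def)
  have c5: "cost (case buf of None \<Rightarrow> [] | Some (v, N) \<Rightarrow> v # sorted_list_of_set N) \<le> (k + l + 1) * (2 * B + 2) + 2"
  proof (cases buf)
    case (Some p)
    then obtain v N where p: "buf = Some (v, N)" "v \<in> pverts G" "N \<subseteq> X \<union> representatives s" using buf by auto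
    have "card N \<le> card (X \<union> representatives s)" using p fin by (intro card_mono) auto
    hence "card N \<le> k + l" using Un by simp
    moreover have "finite N" using p fin finite_subset by blast
    moreover have "m < 2 ^ B" if "m \<in> insert v N" for m using that p small RV X_V by blast
    ultimately show ?thesis unfolding p option.case prod.case by (intro cost_buffer)
  qed (simp add: cost_Nil)
  have "length (multi.encode (s, buf)) \<le> (k + l + 1) * (2 * B + 2) + 2 + (k * (2 * B + 2) + 2)
      + (l * (2 * B + 2) + 2) + (5 * (2 * (k + B + 3) + 2) + 2) + ((k + l) * (2 * (B + 3) + 2) + 2) + 1"
    unfolding multi.encode_def length_code multi_flat_def
    using c1 c2 c3 c4 c5 by (simp add: X)
  also have "\<dots> = 6 * ((k + l) * B) + 12 * (k + l) + 10 * k + 12 * B + 53"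
    by (simp add: algebra_simps)
  also have "\<dots> \<le> 100 * ((k + l) * B)"
  proof -
    \<comment> \<open>Every term is a multiple of something at most \<open>q\<close>; the
      coefficients sum to 93.\<close>
    have "6 * q + 12 * m + 10 * k + 12 * B + 53 \<le> 100 * q"
      if "m \<le> q" "k \<le> m" "1 \<le> q" "B \<le> q" for q m using that by linarith
    moreover have "k + l \<le> (k + l) * B" "k \<le> k + l" "1 \<le> (k + l) * B" "B \<le> (k + l) * B" using n V by auto
    ultimately show ?thesis by blast
  qed
  finally show ?thesis .
qed

lemma multi_pass_outputs:
  assumes inst: "instance_of n k l G X" and stream: "al_stream G \<sigma>"
  shows "outputs_within multi.alg n X \<sigma> (diameter G) (max 1 (200 * (2 ^ k * real k * real l)))
    (200 * (real (k + l) * log 2 (real n)))"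
proof (cases "n < 2")
  case True
  have "1 \<le> n" using instance_of_n[OF inst] inst unfolding instance_of_def by linarith
  thus ?thesis using True diameter_singleton[OF inst] by (auto intro!: multi.outputs_trivial)
next
  case False
  interpret clique_modulator_graph G X using inst by (rule instance_of_modulator)
  obtain B where B: "1 \<le> B" "n \<le> 2 ^ B" "real B \<le> 2 * log 2 (real n)"
    using bit_width False by (metis not_less)
  have V: "pverts G = {..<n}" "card X = k" "1 \<le> l" using inst unfolding instance_of_def by blast+
  have card: "2 \<le> card (pverts G)" using V False by simp
  have bits: "real (length (multi.encode (s, buf))) \<le> 200 * (real (k + l) * log 2 (real n))"
    if "multi_inv G X s" "buf = None \<or> (\<exists>v N. buf = Some (v, N) \<and> v \<in> pverts G \<and> N \<subseteq> X \<union> representatives s)" for s buf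
  proof -
    have "real (length (multi.encode (s, buf))) \<le> real (100 * ((k + l) * B))"
      using multi_bits[OF inst B(2,1) that] by (rule of_nat_mono)
    also have "\<dots> = 100 * (real (k + l) * real B)" by simp
    also have "\<dots> \<le> 100 * (real (k + l) * (2 * log 2 (real n)))"
      using B(3) by (intro mult_left_mono) auto
    finally show ?thesis by simp
  qed
  have reps: "\<exists>R. represented G X R \<and> card R \<le> l \<and>
      multi_end (multi.scan G (multi_init X) vs) = begin_source 0 0 ((multi_init X)\<lparr>representatives := R\<rparr>)"
    if vs: "set vs = pverts G" for vs
  proof -
    obtain R where R: "multi.scan G (multi_init X) vs = (multi_init X)\<lparr>representatives := R\<rparr>" "rep_set R"
      "\<forall>v\<in>set vs - X. \<exists>r. is_lab R v r"
      using multi_scan_reps[of "multi_init X" vs] vs rep_set_empty by (auto simp: multi_init_def)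
    have "represented G X R" using R vs by unfold_locales auto
    moreover have "card R \<le> l" using R(2) by (intro instance_of_independent[OF inst]) (auto simp: rep_set_def)
    ultimately show ?thesis using R(1) by (intro exI[of _ R]) (simp add: multi_end_def multi_init_def)
  qed
  have run: "\<exists>p. real p \<le> max 1 (200 * (2 ^ k * real k * real l)) \<and>
      (\<forall>q<p. multi_out (((\<lambda>s. multi_end (multi.scan G s vs)) ^^ q) (multi_init X)) = None) \<and>
      multi_out (((\<lambda>s. multi_end (multi.scan G s vs)) ^^ p) (multi_init X)) = Some (diameter G)"
    if vs: "set vs = pverts G" for vs
  proof -
    obtain R where R: "represented G X R" "card R \<le> l"
      "multi_end (multi.scan G (multi_init X) vs) = begin_source 0 0 ((multi_init X)\<lparr>representatives := R\<rparr>)"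
      using reps[OF vs] by blast
    interpret represented G X R by fact
    define s where "s = begin_source 0 0 ((multi_init X)\<lparr>representatives := R\<rparr>)"
    \<comment> \<open>Splits off the pass that gathers the representatives.\<close>
    have shift: "(pass vs ^^ Suc q) (multi_init X) = (pass vs ^^ q) s" for q
      using R(3) funpow_Suc_right[of q "pass vs"] by (simp add: s_def del: funpow.simps)
    have out0: "multi_out (multi_init X) = None" by (simp add: multi_out_def multi_init_def)
    show ?thesis
    proof (cases "X = {}")
      case True
      have "multi_out s = Some (diameter G)"
        using diameter_no_modulator[OF True card] True
        by (simp add: s_def multi_out_def begin_source_def multi_init_def)
      thus ?thesis using shift[of 0] out0 by (intro exI[of _ 1]) (simp add: s_def R(3))
    next
      case X: False
      hence k: "1 \<le> k" using V X finite_X card_gt_0_iff[of X] by auto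
      have ready: "ready 0 s"
        by (simp add: s_def ready_def at_phase_def begin_source_def multi_init_def)
      have so_far: "so_far 0 (best s)"
        using card by (auto simp: s_def so_far_def begin_source_def multi_init_def ex_in_conv)
      define p where "p = length srcs * cap"
      have "p = (k + card R * 2 ^ k) * (3 * k + 2)"
        using length_sources[OF finite_X, of R] V by (simp add: p_def cap_def)
      also have "\<dots> \<le> (2 ^ k * l + l * 2 ^ k) * (5 * k)"
      proof (rule mult_le_mono[OF add_le_mono])
        have "k \<le> 2 ^ k * 1" using less_exp[of k] by simp
        also have "\<dots> \<le> 2 ^ k * l" using V(3) by (intro mult_le_mono2)
        finally show "k \<le> 2 ^ k * l" .
        show "card R * 2 ^ k \<le> l * 2 ^ k" using R(2) by (rule mult_le_mono1)
        show "3 * k + 2 \<le> 5 * k" using k by simp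
      qed
      finally have "Suc p \<le> Suc (10 * (2 ^ k * k * l))" by (simp add: algebra_simps)
      \<comment> \<open>As k and l are positive, 11 would do; 200 is the constant of the memory
        bound.\<close>
      also have "\<dots> \<le> 200 * (2 ^ k * k * l)" using k V(3) by (simp add: Suc_le_eq)
      finally have "real (Suc p) \<le> real (200 * (2 ^ k * k * l))" by (rule of_nat_mono)
      also have "\<dots> \<le> max 1 (200 * (2 ^ k * real k * real l))" by simp
      finally have "real (Suc p) \<le> max 1 (200 * (2 ^ k * real k * real l))" .
      moreover have "multi_out ((pass vs ^^ q) (multi_init X)) = None" if "q < Suc p" for q
        using that out0 shift multi_run(1)[OF vs ready so_far card X]
        by (cases q) (auto simp: p_def simp del: funpow.simps(2))
      moreover have "multi_out ((pass vs ^^ Suc p) (multi_init X)) = Some (diameter G)"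
        unfolding shift p_def by (rule multi_run(2)[OF vs ready so_far card X])
      ultimately show ?thesis by blast
    qed
  qed
  show ?thesis
  proof (rule multi.outputs_withinI[where I = "multi_inv G X"])
    show "real (length (multi.encode (s, Some (v, N)))) \<le> 200 * (real (k + l) * log 2 (real n))"
      if "multi_inv G X s" "v \<in> pverts G" "N \<subseteq> nbrs G v \<inter> (modulator s \<union> representatives s)" for s v N
      using that by (intro bits) (auto simp: multi_inv_def)
  qed (use False finite_X stream bits run multi_inv_init multi_inv_commit multi_inv_end in auto)
qed

section \<open>Connectivity\<close>

definition map_result :: "('o \<Rightarrow> 'p) \<Rightarrow> 'o streaming_alg \<Rightarrow> 'p streaming_alg" where
  "map_result f A = \<lparr>init_mem = init_mem A, step = step A, result = map_option f \<circ> result A\<rparr>"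

lemma outputs_within_map_result:
  "outputs_within A n X \<sigma> ans p b \<Longrightarrow> outputs_within (map_result f A) n X \<sigma> (f ans) p b"
  unfolding outputs_within_def mem_after_def by (auto simp: map_result_def)

lemma solvable_connectivityI:
  assumes "\<And>n k l G X \<sigma>. instance_of n k l G X \<Longrightarrow> al_stream G \<sigma> \<Longrightarrow> outputs_within A n X \<sigma> (diameter G) (p n k l) (b n k l)"
  shows "solvable_with_clique_modulator connectivity p b"
proof (rule solvableI)
  fix n k l G X \<sigma> assume inst: "instance_of n k l G X" and stream: "al_stream G \<sigma>"
  interpret clique_modulator_graph G X using inst by (rule instance_of_modulator)
  have "pverts G = {..<n}" "1 \<le> l" using inst unfolding instance_of_def by blast+
  hence "pverts G \<noteq> {}" using instance_of_n[OF inst] by (auto simp: lessThan_empty_iff)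
  hence "connectivity G = (diameter G \<noteq> \<infinity>)" by (rule connectivity_iff)
  thus "outputs_within (map_result (\<lambda>d. d \<noteq> \<infinity>) A) n X \<sigma> (connectivity G) (p n k l) (b n k l)"
    using outputs_within_map_result[OF assms[OF inst stream], of "\<lambda>d. d \<noteq> \<infinity>"] by simp
qed

lemma outputs_within_mono:
  "outputs_within A n X \<sigma> ans p b \<Longrightarrow> p \<le> p' \<Longrightarrow> b \<le> b' \<Longrightarrow> outputs_within A n X \<sigma> ans p' b'"
  unfolding outputs_within_def by (meson order_trans)

theorem theorem4:
  shows "\<exists>C :: real. C > 0 \<and>
    (let multi_passes = (\<lambda>n k l :: nat. max 1 (C * (2 ^ k * real k * real l)));
         multi_bits = (\<lambda>n k l :: nat. C * (real (k + l) * log 2 (real n)));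
         one_pass = (\<lambda>n k l :: nat. 1);
         one_bits = (\<lambda>n k l :: nat. C * (2 ^ k * real l + real (k + l) * log 2 (real n)))
     in solvable_with_clique_modulator diameter multi_passes multi_bits \<and>
        solvable_with_clique_modulator connectivity multi_passes multi_bits \<and>
        solvable_with_clique_modulator diameter one_pass one_bits \<and>
        solvable_with_clique_modulator connectivity one_pass one_bits)"
proof (intro exI[of _ "200 :: real"] conjI)
  have one: "outputs_within one.alg n X \<sigma> (diameter G) 1 (200 * (2 ^ k * real l + real (k + l) * log 2 (real n)))"
    if inst: "instance_of n k l G X" and stream: "al_stream G \<sigma>" for n k l G X \<sigma>
  proof (rule outputs_within_mono[OF one_pass_outputs[OF inst stream]])
    \<comment> \<open>Makes the logarithm nonnegative, so that 100 may be raised to the common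
      constant 200.\<close>
    have "1 \<le> n" using instance_of_n[OF inst] inst unfolding instance_of_def by linarith
    hence "0 \<le> 2 ^ k * real l + real (k + l) * log 2 (real n)" by simp
    thus "100 * (2 ^ k * real l + real (k + l) * log 2 (real n))
        \<le> 200 * (2 ^ k * real l + real (k + l) * log 2 (real n))"
      by (rule mult_right_mono[rotated]) simp
  qed simp
  show "let multi_passes = (\<lambda>n k l :: nat. max 1 (200 * (2 ^ k * real k * real l)));
         multi_bits = (\<lambda>n k l :: nat. 200 * (real (k + l) * log 2 (real n)));
         one_pass = (\<lambda>n k l :: nat. 1);
         one_bits = (\<lambda>n k l :: nat. 200 * (2 ^ k * real l + real (k + l) * log 2 (real n)))
     in solvable_with_clique_modulator diameter multi_passes multi_bits \<and>
        solvable_with_clique_modulator connectivity multi_passes multi_bits \<and>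
        solvable_with_clique_modulator diameter one_pass one_bits \<and>
        solvable_with_clique_modulator connectivity one_pass one_bits"
    unfolding Let_def
    by (intro conjI, (rule solvableI solvable_connectivityI; erule (1) multi_pass_outputs one)+)
qed simp

end
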